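(* Let $n\ge1$ and let $S$ be an admissible subset of $\{r,b,g,o,y,s\}$ with $|S|=3$ and $S\notin\{\{r,g,y\},\{s,b,r\}\}$. Then \[F(J(T_n(S)),q)=\prod_{j=1}^{n-1}(1+q^j)^{n-j}=\prod_{1\le i\le j\le k\le n-1}\frac{[i+j]_q}{[i+j-1]_q}.\] In particular $|J(T_n(S))|=2^{\binom n2}$.
   Context: For an integer $n\ge1$, let $T_n$ be the set of triples $(c_1,c_2,c_3)$ of nonnegative integers with $c_1+c_2+c_3\le n-2$. Six colors are associated to vectors: red $r=(1,0,0)$, green $g=(0,1,0)$, yellow $y=(0,0,1)$, blue $b=(-1,1,0)$, orange $o=(-1,0,1)$, silver $s=(0,1,-1)$. For $S\subseteq\{r,b,g,o,y,s\}$, $T_n(S)$ is the poset on $T_n$ whose order relation is the reflexive–transitive closure of the relations $u<u+v$ for all $u,u+v\in T_n$ and $v$ the vector of a color in $S$. A subset $S$ is admissible if: $\{r,b\}\subseteq S\Rightarrow g\in S$; $\{o,s\}\subseteq S\Rightarrow b\in S$; $\{s,y\}\subseteq S\Rightarrow g\in S$; $\{r,o\}\subseteq S\Rightarrow y\in S$. $J(P)$ denotes the set of order ideals of a poset $P$, $F(J(P),q)=\sum_{I\in J(P)}q^{|I|}$, and $[m]_q=1+q+\dots+q^{m-1}$.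
   Formalization: The second excluded set is read as {s,b,g} instead of {s,b,r}: {s,b,r} is not admissible, and the claim fails for the admissible set {s,b,g} at n=3, where there are 9 order ideals, not 8. *)

theory Defs
  imports
    "HOL-Library.Product_Plus"
    "HOL-Computational_Algebra.Polynomial_Factorial"
begin

section \<open>Order ideals and their size generating function\<close>

definition order_ideals :: "'a set \<Rightarrow> ('a \<times> 'a) set \<Rightarrow> 'a set set" where
  "order_ideals P r = {I. I \<subseteq> P \<and> (\<forall>x\<in>I. \<forall>y\<in>P. (y, x) \<in> r \<longrightarrow> y \<in> I)}"

text \<open>The indeterminate \<open>q\<close> is \<^term>\<open>monom 1 1 :: int poly\<close>, so \<open>q\<^sup>k\<close> is
  \<^term>\<open>monom 1 k :: int poly\<close>.\<close>

definition ideal_gf :: "'a set set \<Rightarrow> int poly" where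
  "ideal_gf J = (\<Sum>I\<in>J. monom 1 (card I))"

definition q_int :: "nat \<Rightarrow> int poly" where
  "q_int m = (\<Sum>i<m. monom 1 i)"


section \<open>Tetrahedral posets\<close>

datatype color = Red | Green | Yellow | Blue | Orange | Silver

type_synonym point = "int \<times> int \<times> int"

fun vec :: "color \<Rightarrow> point" where
  "vec Red = (1, 0, 0)"
| "vec Green = (0, 1, 0)"
| "vec Yellow = (0, 0, 1)"
| "vec Blue = (-1, 1, 0)"
| "vec Orange = (-1, 0, 1)"
| "vec Silver = (0, 1, -1)"

definition T :: "nat \<Rightarrow> point set" where
  "T n = {(c1, c2, c3). 0 \<le> c1 \<and> 0 \<le> c2 \<and> 0 \<le> c3 \<and> c1 + c2 + c3 \<le> int n - 2}"

definition T_step :: "nat \<Rightarrow> color set \<Rightarrow> (point \<times> point) set" where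
  "T_step n S = {(u, u + vec c) | u c. c \<in> S \<and> u \<in> T n \<and> u + vec c \<in> T n}"

text \<open>The intersection only discards the pairs \<open>(u, u)\<close> with \<open>u\<close> outside \<^term>\<open>T n\<close>.\<close>

definition T_order :: "nat \<Rightarrow> color set \<Rightarrow> (point \<times> point) set" where
  "T_order n S = (T_step n S)\<^sup>* \<inter> T n \<times> T n"

definition admissible :: "color set \<Rightarrow> bool" where
  "admissible S \<longleftrightarrow>
     ({Red, Blue} \<subseteq> S \<longrightarrow> Green \<in> S) \<and>
     ({Orange, Silver} \<subseteq> S \<longrightarrow> Blue \<in> S) \<and>
     ({Silver, Yellow} \<subseteq> S \<longrightarrow> Green \<in> S) \<and>
     ({Red, Orange} \<subseteq> S \<longrightarrow> Yellow \<in> S)"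

lemma finite_T: "finite (T n)"
proof (rule finite_subset)
  show "T n \<subseteq> {0..int n} \<times> {0..int n} \<times> {0..int n}"
    by (auto simp: T_def)
qed auto

lemma partial_order_on_T: "partial_order_on (T n) (T_order n S)"
proof -
  define f :: "point \<Rightarrow> int" where "f = (\<lambda>(a, b, c). a + 3 * b + 2 * c)"
  have step: "f u < f v" if "(u, v) \<in> T_step n S" for u v
  proof -
    from that obtain c where "v = u + vec c" by (auto simp: T_step_def)
    then show ?thesis by (cases c; cases u) (auto simp: f_def)
  qed
  have star: "u = v \<or> f u < f v" if "(u, v) \<in> (T_step n S)\<^sup>*" for u v
    using that by (induction rule: rtrancl_induct) (auto dest: step)
  show ?thesis
    unfolding partial_order_on_def preorder_on_def refl_on_def trans_def antisym_def T_order_def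
    using star by (auto dest: rtrancl_trans) (force dest: star)+
qed


section \<open>The excluded color sets\<close>

text \<open>The source excludes the sets red, green, yellow and silver, blue, red. The latter is not
  admissible, so excluding it has no effect, while the claim fails for the admissible set silver,
  blue, green (whose order is dual to that of red, green, yellow) already at \<open>n = 3\<close>. The second
  exclusion is therefore read as silver, blue, green.\<close>

lemma not_admissible_silver_blue_red: "\<not> admissible {Silver, Blue, Red}"
  by (simp add: admissible_def)

lemma admissible_silver_blue_green: "admissible {Silver, Blue, Green}"
  by (simp add: admissible_def)

lemma silver_blue_green_counterexample:
  "card (order_ideals (T 3) (T_order 3 {Silver, Blue, Green})) > 2 ^ (3 choose 2)"
proof -
  let ?J = "order_ideals (T 3) (T_order 3 {Silver, Blue, Green})"
  let ?M = "{(0, 0, 0), (1, 0, 0), (0, 0, 1)} :: point set"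
  have minimal: "u = v" if "(u, v) \<in> (T_step 3 {Silver, Blue, Green})\<^sup>*" "v \<in> ?M" for u v
    using that by (cases rule: rtranclE) (auto simp: T_step_def T_def)
  have M: "?M \<subseteq> T 3"
    by (auto simp: T_def)
  have "Pow ?M \<subseteq> ?J"
  proof
    fix A assume "A \<in> Pow ?M"
    then have A: "A \<subseteq> ?M" by (rule PowD)
    have "y \<in> A" if "x \<in> A" "(y, x) \<in> T_order 3 {Silver, Blue, Green}" for x y
    proof -
      have "(y, x) \<in> (T_step 3 {Silver, Blue, Green})\<^sup>*"
        using that(2) unfolding T_order_def by (rule IntD1)
      moreover have "x \<in> ?M"
        using A that(1) by (rule subsetD)
      ultimately have "y = x"
        by (rule minimal)
      then show "y \<in> A"
        using that(1) by (simp only:)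
    qed
    then show "A \<in> ?J"
      using subset_trans[OF A M] unfolding order_ideals_def by blast
  qed
  moreover have "T 3 \<in> ?J"
    by (auto simp: order_ideals_def)
  moreover have "finite ?J"
    by (rule finite_subset[of _ "Pow (T 3)"]) (auto simp: order_ideals_def finite_T)
  ultimately have "card (insert (T 3) (Pow ?M)) \<le> card ?J"
    by (intro card_mono) (simp_all only: insert_subset)
  moreover have "(0, 1, 0) \<in> T 3 - ?M"
    by (auto simp: T_def)
  then have "T 3 \<notin> Pow ?M"
    by blast
  then have "card (insert (T 3) (Pow ?M)) = 9"
    by (subst card_insert_disjoint) (simp_all add: card_Pow del: Pow_iff)
  ultimately show ?thesis
    by (simp add: choose_two)
qed

end

(*
  The six colours are the directed edges of a tetrahedron with vertices O < R < Y < G, a point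
  (c1, c2, c3) is the vector of barycentric weights (n - 2 - c1 - c2 - c3, c1, c3, c2), and a step
  moves one unit of weight along an edge. Admissible sets are the transitively closed ones, so the
  admissible three-element sets are partial orders on the vertices: two claws (excluded), four
  3-chains with an isolated point, and five zigzags. Permuting the vertices reduces the chains to
  {Red, Green, Blue} and the zigzags to {Red, Green, Silver}.

  For the chain, the slices c3 = const are triangles whose ideals are strict partitions with parts
  of size at most t, counted by (1 + q) ... (1 + q^t).

  For the zigzag, recording the height of an ideal on each Green line turns ideals into strict
  Gelfand-Tsetlin patterns with top row 0, 2, 4, ..., that is, semistandard tableaux of staircase
  shape. Summing out one row at a time sends a Vandermonde determinant to a larger one, which gives
  the generating function as a quotient of the Vandermonde products in q^2 and in q.
*)

theory Submission
  imports "Jordan_Normal_Form.Determinant" Defs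
begin

section \<open>Order ideals and symmetries of the tetrahedron\<close>

definition ideals :: "'a set \<Rightarrow> ('a \<times> 'a) set \<Rightarrow> 'a set set" where
  "ideals P E = {I. I \<subseteq> P \<and> (\<forall>(u, v)\<in>E. v \<in> I \<longrightarrow> u \<in> I)}"

lemma idealsI: "I \<subseteq> P \<Longrightarrow> (\<And>u v. (u, v) \<in> E \<Longrightarrow> v \<in> I \<Longrightarrow> u \<in> I) \<Longrightarrow> I \<in> ideals P E"
  unfolding ideals_def by blast

lemma T_step_iff: "(u, v) \<in> T_step n S \<longleftrightarrow> u \<in> T n \<and> v \<in> T n \<and> (\<exists>c\<in>S. v = u + vec c)"
  unfolding T_step_def by blast

text \<open>Closure under single steps propagates along paths. From here on only the generating
  relation is used, never its transitive closure.\<close>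

lemma order_ideals_T_order: "order_ideals (T n) (T_order n S) = ideals (T n) (T_step n S)"
proof (intro Set.set_eqI iffI)
  fix I assume I: "I \<in> order_ideals (T n) (T_order n S)"
  have "u \<in> I" if "(u, v) \<in> T_step n S" "v \<in> I" for u v
  proof -
    from that(1) have uv: "u \<in> T n" "v \<in> T n"
      by (auto simp: T_step_iff)
    with that(1) have "(u, v) \<in> T_order n S"
      by (auto simp: T_order_def)
    with I uv \<open>v \<in> I\<close> show ?thesis
      by (auto simp: order_ideals_def)
  qed
  with I show "I \<in> ideals (T n) (T_step n S)"
    by (auto simp: order_ideals_def ideals_def)
next
  fix I assume I: "I \<in> ideals (T n) (T_step n S)"
  have "u \<in> I" if "(u, v) \<in> (T_step n S)\<^sup>*" "v \<in> I" for u v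
    using that by (induction rule: converse_rtrancl_induct) (use I in \<open>auto simp: ideals_def\<close>)
  with I show "I \<in> order_ideals (T n) (T_order n S)"
    by (auto simp: order_ideals_def ideals_def T_order_def)
qed

section \<open>Transport of the generating function along bijections\<close>

lemma ideal_gf_ideals_bij:
  assumes bij: "bij_betw f P P'"
    and E: "E \<subseteq> P \<times> P" "E' \<subseteq> P' \<times> P'"
    and edge: "\<And>u v. u \<in> P \<Longrightarrow> v \<in> P \<Longrightarrow> (f u, f v) \<in> E' \<longleftrightarrow> (u, v) \<in> E"
  shows "ideal_gf (ideals P E) = ideal_gf (ideals P' E')"
  unfolding ideal_gf_def
proof (rule sum.reindex_bij_witness[of _ "\<lambda>I. {u \<in> P. f u \<in> I}" "\<lambda>I. f ` I"])
  have inj: "inj_on f P" and surj: "f ` P = P'"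
    using bij by (auto simp: bij_betw_def)
  show "{u \<in> P. f u \<in> f ` I} = I" if "I \<in> ideals P E" for I
    using that inj by (auto simp: ideals_def inj_on_def)
  show "f ` {u \<in> P. f u \<in> I} = I" if "I \<in> ideals P' E'" for I
    using that surj by (auto simp: ideals_def)
  show "{u \<in> P. f u \<in> I} \<in> ideals P E" if "I \<in> ideals P' E'" for I
    using that E edge unfolding ideals_def by blast
  show "f ` I \<in> ideals P' E'" if I: "I \<in> ideals P E" for I
  proof -
    have "u \<in> f ` I" if "(u, v) \<in> E'" "v \<in> f ` I" for u v
    proof -
      from that I obtain v' where v': "v' \<in> P" "v' \<in> I" "v = f v'"
        by (auto simp: ideals_def)
      from that(1) E surj obtain u' where "u' \<in> P" "u = f u'"
        by blast
      with v' that(1) edge have "(u', v') \<in> E"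
        by blast
      with I v' \<open>u = f u'\<close> show ?thesis
        by (auto simp: ideals_def)
    qed
    with I surj show ?thesis
      by (auto simp: ideals_def)
  qed
  show "(monom 1 (card (f ` I)) :: int poly) = monom 1 (card I)" if "I \<in> ideals P E" for I
    using that inj card_image[of f I] inj_on_subset by (fastforce simp: ideals_def)
qed

text \<open>Intended for the affine map \<open>f\<close> induced by a permutation of the four
  vertices, with \<open>\<kappa>\<close> its action on directed edges. Since \<open>g\<close>
  inverts \<open>f\<close> on all integer points, \<open>f v = f u + vec (\<kappa> c)\<close> is
  equivalent to \<open>v = u + vec c\<close>, so the boundary of \<open>T n\<close> needs no
  separate treatment.\<close>

lemma ideal_gf_T_iso:
  assumes fT: "\<And>u. u \<in> T n \<Longrightarrow> f u \<in> T n" and gT: "\<And>u. u \<in> T n \<Longrightarrow> g u \<in> T n"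
    and gf: "\<And>u. g (f u) = u" and fg: "\<And>u. f (g u) = u"
    and vec: "\<And>u c. c \<in> S \<Longrightarrow> f (u + vec c) = f u + vec (\<kappa> c)"
    and S': "S' = \<kappa> ` S"
  shows "ideal_gf (ideals (T n) (T_step n S)) = ideal_gf (ideals (T n) (T_step n S'))"
proof (rule ideal_gf_ideals_bij)
  show "bij_betw f (T n) (T n)"
    by (rule bij_betw_byWitness[of _ g]) (use fT gT gf fg in auto)
  show "T_step n S \<subseteq> T n \<times> T n" "T_step n S' \<subseteq> T n \<times> T n"
    by (auto simp: T_step_def)
  show "(f u, f v) \<in> T_step n S' \<longleftrightarrow> (u, v) \<in> T_step n S" if "u \<in> T n" "v \<in> T n" for u v
  proof -
    have "(f u, f v) \<in> T_step n S' \<longleftrightarrow> (\<exists>c\<in>S. f v = f u + vec (\<kappa> c))"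
      unfolding T_step_iff S' using that fT by blast
    also have "\<dots> \<longleftrightarrow> (\<exists>c\<in>S. v = u + vec c)"
      by (metis vec gf)
    also have "\<dots> \<longleftrightarrow> (u, v) \<in> T_step n S"
      unfolding T_step_iff using that by blast
    finally show ?thesis .
  qed
qed

section \<open>Reduction to one chain and one zigzag\<close>

lemma admissible_card_3_cases:
  assumes "admissible S" "card S = 3" "S \<notin> {{Red, Green, Yellow}, {Silver, Blue, Green}}"
  shows "S \<in> {{Red, Green, Blue}, {Green, Yellow, Silver}, {Red, Yellow, Orange}, {Blue, Orange, Silver}}
    \<or> S \<in> {{Red, Green, Silver}, {Green, Yellow, Blue}, {Green, Yellow, Orange},
           {Green, Blue, Orange}, {Yellow, Blue, Orange}}"
proof -
  \<comment> \<open>Writing \<open>S\<close> through its six memberships turns the classification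
    into 64 ground instances that simplification decides.\<close>
  have S: "S = (if Red \<in> S then {Red} else {}) \<union> (if Green \<in> S then {Green} else {})
    \<union> (if Yellow \<in> S then {Yellow} else {}) \<union> (if Blue \<in> S then {Blue} else {})
    \<union> (if Orange \<in> S then {Orange} else {}) \<union> (if Silver \<in> S then {Silver} else {})" (is "_ = ?R")
  proof (rule Set.set_eqI)
    fix c show "c \<in> S \<longleftrightarrow> c \<in> ?R" by (cases c) simp_all
  qed
  have "admissible ?R" "card ?R = 3" "?R \<notin> {{Red, Green, Yellow}, {Silver, Blue, Green}}"
    using assms S by simp_all
  then have "?R \<in> {{Red, Green, Blue}, {Green, Yellow, Silver}, {Red, Yellow, Orange}, {Blue, Orange, Silver}}
    \<or> ?R \<in> {{Red, Green, Silver}, {Green, Yellow, Blue}, {Green, Yellow, Orange},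
           {Green, Blue, Orange}, {Yellow, Blue, Orange}}"
    by (cases "Red \<in> S"; cases "Green \<in> S"; cases "Yellow \<in> S"; cases "Blue \<in> S";
        cases "Orange \<in> S"; cases "Silver \<in> S") (simp_all add: admissible_def insert_commute)
  then show ?thesis
    using S by simp
qed

text \<open>Each \<open>f\<close> permutes the barycentric weights so that the chain becomes O < R <
  G. The expression \<open>int n - 2 - a - b - c\<close> is the weight of O; it moves only for the
  chain R < Y < G, where O is the isolated vertex.\<close>

lemma ideal_gf_T_chain:
  assumes "S \<in> {{Red, Green, Blue}, {Green, Yellow, Silver}, {Red, Yellow, Orange}, {Blue, Orange, Silver}}"
  shows "ideal_gf (ideals (T n) (T_step n S)) = ideal_gf (ideals (T n) (T_step n {Red, Green, Blue}))"
  using assms unfolding insert_iff empty_iff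
proof (elim disjE FalseE)
  assume "S = {Green, Yellow, Silver}"
  then show ?thesis
    by (intro ideal_gf_T_iso[where f = "\<lambda>(a, b, c). (c, b, a)" and g = "\<lambda>(a, b, c). (c, b, a)"
        and \<kappa> = "\<lambda>c. if c = Green then Green else if c = Yellow then Red else Blue"])
      (auto simp: T_def)
next
  assume "S = {Red, Yellow, Orange}"
  then show ?thesis
    by (intro ideal_gf_T_iso[where f = "\<lambda>(a, b, c). (a, c, b)" and g = "\<lambda>(a, b, c). (a, c, b)"
        and \<kappa> = "\<lambda>c. if c = Red then Red else if c = Yellow then Green else Blue"])
      (auto simp: T_def)
next
  assume "S = {Blue, Orange, Silver}"
  then show ?thesis
    by (intro ideal_gf_T_iso[where f = "\<lambda>(a, b, c). (c, b, int n - 2 - a - b - c)"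
        and g = "\<lambda>(a, b, c). (int n - 2 - a - b - c, b, a)"
        and \<kappa> = "\<lambda>c. if c = Blue then Green else if c = Orange then Red else Blue"])
      (auto simp: T_def)
qed simp

text \<open>Each set is a path p > q < r > s on the vertices, and \<open>f\<close> carries it to R >
  O < G > Y. The weight of O moves exactly in the two cases where O is the end s.\<close>

lemma ideal_gf_T_zigzag:
  assumes "S \<in> {{Red, Green, Silver}, {Green, Yellow, Blue}, {Green, Yellow, Orange},
           {Green, Blue, Orange}, {Yellow, Blue, Orange}}"
  shows "ideal_gf (ideals (T n) (T_step n S)) = ideal_gf (ideals (T n) (T_step n {Red, Green, Silver}))"
  using assms unfolding insert_iff empty_iff
proof (elim disjE FalseE)
  assume "S = {Green, Yellow, Blue}"
  then show ?thesis
    by (intro ideal_gf_T_iso[where f = "\<lambda>(a, b, c). (c, b, a)" and g = "\<lambda>(a, b, c). (c, b, a)"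
        and \<kappa> = "\<lambda>c. if c = Green then Green else if c = Yellow then Red else Silver"])
      (auto simp: T_def)
next
  assume "S = {Green, Yellow, Orange}"
  then show ?thesis
    by (intro ideal_gf_T_iso[where f = "\<lambda>(a, b, c). (b, c, a)" and g = "\<lambda>(a, b, c). (c, a, b)"
        and \<kappa> = "\<lambda>c. if c = Green then Red else if c = Yellow then Green else Silver"])
      (auto simp: T_def)
next
  assume "S = {Green, Blue, Orange}"
  then show ?thesis
    by (intro ideal_gf_T_iso[where f = "\<lambda>(a, b, c). (c, b, int n - 2 - a - b - c)"
        and g = "\<lambda>(a, b, c). (int n - 2 - a - b - c, b, a)"
        and \<kappa> = "\<lambda>c. if c = Blue then Green else if c = Orange then Red else Silver"])
      (auto simp: T_def)
next
  assume "S = {Yellow, Blue, Orange}"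
  then show ?thesis
    by (intro ideal_gf_T_iso[where f = "\<lambda>(a, b, c). (b, c, int n - 2 - a - b - c)"
        and g = "\<lambda>(a, b, c). (int n - 2 - a - b - c, a, b)"
        and \<kappa> = "\<lambda>c. if c = Orange then Green else if c = Blue then Red else Silver"])
      (auto simp: T_def)
qed simp

section \<open>Chains\<close>

text \<open>Red closure makes row \<open>b\<close> an initial segment, and Blue closure makes every
  nonempty row shorter than the row before it. A Green step is a Red step followed by a Blue step,
  so its closure is implied. The row lengths thus form a strict partition with parts at most
  \<open>t\<close>.\<close>

definition stair :: "nat \<Rightarrow> (nat \<times> nat) set set" where
  "stair t = {I. I \<subseteq> {(a, b). a + b < t} \<and> (\<forall>a b. (Suc a, b) \<in> I \<longrightarrow> (a, b) \<in> I)
     \<and> (\<forall>a b. (a, Suc b) \<in> I \<longrightarrow> (Suc a, b) \<in> I)}"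

definition tower :: "nat \<Rightarrow> (nat \<times> nat \<times> nat) set set" where
  "tower M = {I. I \<subseteq> {(a, b, c). a + b + c < M} \<and> (\<forall>a b c. (Suc a, b, c) \<in> I \<longrightarrow> (a, b, c) \<in> I)
     \<and> (\<forall>a b c. (a, Suc b, c) \<in> I \<longrightarrow> (Suc a, b, c) \<in> I)}"

lemma finite_triangle: "finite {(a, b). a + b < (t :: nat)}"
  by (rule finite_subset[of _ "{..<t} \<times> {..<t}"]) auto

lemma finite_tetrahedron: "finite {(a, b, c). a + b + c < (t :: nat)}"
  by (rule finite_subset[of _ "{..<t} \<times> {..<t} \<times> {..<t}"]) auto

lemma stair_subset: "I \<in> stair t \<Longrightarrow> I \<subseteq> {(a, b). a + b < t}"
  unfolding stair_def by blast

lemma tower_subset: "I \<in> tower M \<Longrightarrow> I \<subseteq> {(a, b, c). a + b + c < M}"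
  unfolding tower_def by blast

lemma finite_stair: "finite (stair t)"
  by (rule finite_subset[of _ "Pow {(a, b). a + b < t}"]) (use stair_subset finite_triangle in blast)+

lemma stair_finite_mem: "I \<in> stair t \<Longrightarrow> finite I"
  using stair_subset finite_triangle by (rule finite_subset)

lemma tower_finite_mem: "I \<in> tower M \<Longrightarrow> finite I"
  using tower_subset finite_tetrahedron by (rule finite_subset)

lemma stair_bound: "I \<in> stair t \<Longrightarrow> (a, b) \<in> I \<Longrightarrow> a + b < t"
  and stair_left: "I \<in> stair t \<Longrightarrow> (Suc a, b) \<in> I \<Longrightarrow> (a, b) \<in> I"
  and stair_down: "I \<in> stair t \<Longrightarrow> (a, Suc b) \<in> I \<Longrightarrow> (Suc a, b) \<in> I"
  unfolding stair_def by blast+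

lemma stairI:
  assumes "\<And>a b. (a, b) \<in> I \<Longrightarrow> a + b < t"
    and "\<And>a b. (Suc a, b) \<in> I \<Longrightarrow> (a, b) \<in> I"
    and "\<And>a b. (a, Suc b) \<in> I \<Longrightarrow> (Suc a, b) \<in> I"
  shows "I \<in> stair t"
  using assms unfolding stair_def by blast

lemma tower_bound: "I \<in> tower M \<Longrightarrow> (a, b, c) \<in> I \<Longrightarrow> a + b + c < M"
  and tower_left: "I \<in> tower M \<Longrightarrow> (Suc a, b, c) \<in> I \<Longrightarrow> (a, b, c) \<in> I"
  and tower_down: "I \<in> tower M \<Longrightarrow> (a, Suc b, c) \<in> I \<Longrightarrow> (Suc a, b, c) \<in> I"
  unfolding tower_def by blast+

lemma towerI:
  assumes "\<And>a b c. (a, b, c) \<in> I \<Longrightarrow> a + b + c < M"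
    and "\<And>a b c. (Suc a, b, c) \<in> I \<Longrightarrow> (a, b, c) \<in> I"
    and "\<And>a b c. (a, Suc b, c) \<in> I \<Longrightarrow> (Suc a, b, c) \<in> I"
  shows "I \<in> tower M"
  using assms unfolding tower_def by blast

text \<open>Splits the strict partitions by whether the largest possible part \<open>Suc t\<close>
  occurs, that is, whether \<open>(t, 0)\<close> lies in the ideal. The map \<open>prepend\<close>
  inserts this part as row 0 and shifts the other rows up.\<close>

lemma stair_Suc:
  fixes t :: nat
  defines "prepend \<equiv> (\<lambda>I. (\<lambda>a. (a, 0)) ` {..t} \<union> (\<lambda>(a, b). (a, Suc b)) ` I)"
  shows "stair (Suc t) = stair t \<union> prepend ` stair t" "stair t \<inter> prepend ` stair t = {}" "inj_on prepend (stair t)"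
    "\<And>I. I \<in> stair t \<Longrightarrow> card (prepend I) = Suc t + card I"
proof -
  have prepend_0: "(a, 0) \<in> prepend I \<longleftrightarrow> a \<le> t" for a I
    by (auto simp: prepend_def)
  have prepend_Suc: "(a, Suc b) \<in> prepend I \<longleftrightarrow> (a, b) \<in> I" for a b I
    by (auto simp: prepend_def)
  have "I \<in> stair t" if I: "I \<in> stair (Suc t)" "(t, 0) \<notin> I" for I
  proof (rule stairI)
    \<comment> \<open>Blue closure leads down the antidiagonal to row 0, so the absence of
      \<open>(t, 0)\<close> clears the whole diagonal \<open>a + b = t\<close>.\<close>
    have "(a + b, 0) \<in> I" if "(a, b) \<in> I" for a b
      using that
    proof (induction b arbitrary: a)
      case (Suc b)
      then show ?case using stair_down[OF I(1), of a b] Suc.IH[of "Suc a"] by simp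
    qed simp
    then have "a + b \<noteq> t" if "(a, b) \<in> I" for a b
      using that I(2) by metis
    then show "a + b < t" if "(a, b) \<in> I" for a b
      using that stair_bound[OF I(1) that] by (simp add: less_Suc_eq)
  qed (use stair_left[OF I(1)] stair_down[OF I(1)] in blast)+
  moreover have "I \<in> prepend ` stair t" if I: "I \<in> stair (Suc t)" "(t, 0) \<in> I" for I
  proof -
    \<comment> \<open>Red closure fills row 0 leftwards from its last cell; \<open>d\<close> is the
      distance travelled, and \<open>t - d\<close> stays at 0 once \<open>d\<close> exceeds
      \<open>t\<close>.\<close>
    have "(t - d, 0) \<in> I" for d
    proof (induction d)
      case (Suc d)
      then show ?case
        using stair_left[OF I(1), of "t - Suc d" 0] by (cases "d < t") (auto simp: Suc_diff_Suc)
    qed (use I in simp)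
    then have "(a, 0) \<in> I" if "a \<le> t" for a
      using that by (metis diff_diff_cancel)
    moreover have "a \<le> t" if "(a, 0) \<in> I" for a
      using stair_bound[OF I(1) that] by simp
    ultimately have I_0: "(a, 0) \<in> I \<longleftrightarrow> a \<le> t" for a
      by blast
    have "p \<in> I \<longleftrightarrow> p \<in> prepend {(a, b). (a, Suc b) \<in> I}" for p
    proof (cases p)
      case (Pair a b)
      show ?thesis
        unfolding Pair by (cases b) (simp_all add: prepend_0 prepend_Suc I_0)
    qed
    then have "I = prepend {(a, b). (a, Suc b) \<in> I}"
      by blast
    moreover have "{(a, b). (a, Suc b) \<in> I} \<in> stair t"
    proof (rule stairI; unfold mem_Collect_eq prod.case)
      show "a + b < t" if "(a, Suc b) \<in> I" for a b
        using stair_bound[OF I(1) that] by simp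
    qed (fact stair_left[OF I(1)] stair_down[OF I(1)])+
    ultimately show ?thesis
      by blast
  qed
  moreover have "I \<in> stair (Suc t)" if I: "I \<in> stair t" for I
    by (rule stairI) (fact less_SucI[OF stair_bound[OF I]] stair_left[OF I] stair_down[OF I])+
  moreover have "prepend I \<in> stair (Suc t)" if I: "I \<in> stair t" for I
  proof (rule stairI)
    fix a b
    show "a + b < Suc t" if "(a, b) \<in> prepend I"
      using that stair_bound[OF I, of a "b - 1"] by (cases b) (auto simp: prepend_0 prepend_Suc)
    show "(a, b) \<in> prepend I" if "(Suc a, b) \<in> prepend I"
      using that stair_left[OF I, of a "b - 1"] by (cases b) (auto simp: prepend_0 prepend_Suc)
    show "(Suc a, b) \<in> prepend I" if "(a, Suc b) \<in> prepend I"
      using that stair_bound[OF I, of a b] stair_down[OF I, of a "b - 1"]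
      by (cases b) (auto simp: prepend_0 prepend_Suc)
  qed
  ultimately show "stair (Suc t) = stair t \<union> prepend ` stair t"
    by blast
  have "(t, 0) \<in> prepend I" for I
    by (simp add: prepend_0)
  moreover have "(t, 0) \<notin> I" if "I \<in> stair t" for I
    using stair_bound[OF that, of t 0] by auto
  ultimately show "stair t \<inter> prepend ` stair t = {}"
    by blast
  show "inj_on prepend (stair t)"
  proof (rule inj_onI)
    fix I J assume "prepend I = prepend J"
    then have "(a, Suc b) \<in> prepend I \<longleftrightarrow> (a, Suc b) \<in> prepend J" for a b
      by simp
    then show "I = J"
      unfolding prepend_Suc
      by auto
  qed
  show "card (prepend I) = Suc t + card I" if "I \<in> stair t" for I
  proof -
    have "inj_on (\<lambda>(a, b). (a, Suc b)) I"
      by (auto simp: inj_on_def)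
    then show ?thesis
      unfolding prepend_def using stair_finite_mem[OF that]
      by (subst card_Un_disjoint) (auto simp: card_image inj_on_def)
  qed
qed

lemma ideal_gf_stair: "ideal_gf (stair t) = (\<Prod>d = 1..t. 1 + monom 1 d)"
proof (induction t)
  case 0
  have "stair 0 = {{}}"
    using stair_subset[of _ 0] by (auto intro!: stairI)
  then show ?case by (simp add: ideal_gf_def)
next
  case (Suc t)
  have "ideal_gf (stair (Suc t))
      = (\<Sum>I\<in>stair t. monom 1 (card I)) + (\<Sum>I\<in>stair t. monom 1 (Suc t + card I))"
    unfolding ideal_gf_def stair_Suc(1)
    by (subst sum.union_disjoint)
      (simp_all add: finite_stair stair_Suc(2) sum.reindex stair_Suc(3) stair_Suc(4) del: add_Suc)
  also have "\<dots> = ideal_gf (stair t) * (1 + monom 1 (Suc t))"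
    by (simp add: ideal_gf_def distrib_left sum_distrib_right mult_monom add.commute del: add_Suc)
  finally show ?case
    by (simp add: Suc.IH)
qed

text \<open>The coordinate \<open>c\<close> is the weight of the isolated vertex Y, which no step
  changes, so the slices are independent. Slice 0 is the largest triangle; the remaining slices,
  lowered by one, form a smaller tower.\<close>

lemma ideal_gf_tower_Suc: "ideal_gf (tower (Suc M)) = ideal_gf (tower M) * ideal_gf (stair (Suc M))"
proof -
  let ?join = "\<lambda>(I, K). (\<lambda>(a, b, c). (a, b, Suc c)) ` I \<union> (\<lambda>(a, b). (a, b, 0)) ` K"
  have join_iff: "(a, b, 0) \<in> ?join (I, K) \<longleftrightarrow> (a, b) \<in> K"
    "(a, b, Suc c) \<in> ?join (I, K) \<longleftrightarrow> (a, b, c) \<in> I" for a b c I K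
    by (force simp: image_iff)+
  have "ideal_gf (tower M) * ideal_gf (stair (Suc M))
      = (\<Sum>(I, K)\<in>tower M \<times> stair (Suc M). monom 1 (card I + card K))"
    unfolding ideal_gf_def sum_product sum.cartesian_product by (simp add: mult_monom)
  also have "\<dots> = (\<Sum>I\<in>tower (Suc M). monom 1 (card I))"
  proof (rule sum.reindex_bij_witness[of _
        "\<lambda>I. ({(a, b, c). (a, b, Suc c) \<in> I}, {(a, b). (a, b, 0) \<in> I})" ?join])
    fix IK assume "IK \<in> tower M \<times> stair (Suc M)"
    then obtain I K where IK: "IK = (I, K)" "I \<in> tower M" "K \<in> stair (Suc M)"
      by auto
    show "({(a, b, c). (a, b, Suc c) \<in> ?join IK}, {(a, b). (a, b, 0) \<in> ?join IK}) = IK"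
      unfolding IK(1) join_iff by simp
    have "inj_on (\<lambda>(a, b, c). (a, b, Suc c)) I" "inj_on (\<lambda>(a, b). (a, b, 0 :: nat)) K"
      by (auto simp: inj_on_def)
    then have "card (?join IK) = card I + card K"
      using tower_finite_mem[OF IK(2)] stair_finite_mem[OF IK(3)] unfolding IK(1) prod.case
      by (subst card_Un_disjoint) (auto simp: card_image)
    then show "monom 1 (card (?join IK)) = (case IK of (I, K) \<Rightarrow> monom 1 (card I + card K))"
      by (simp add: IK(1))
    note I = tower_bound[OF IK(2)] tower_left[OF IK(2)] tower_down[OF IK(2)]
      and K = stair_bound[OF IK(3)] stair_left[OF IK(3)] stair_down[OF IK(3)]
    have "a + b + c < Suc M" if "(a, b, c) \<in> ?join (I, K)" for a b c
    proof (cases c)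
      case 0
      then show ?thesis using that K(1)[of a b] unfolding 0 join_iff by simp
    next
      case (Suc c')
      then show ?thesis using that I(1)[of a b c'] unfolding Suc join_iff by simp
    qed
    moreover have "(a, b, c) \<in> ?join (I, K)" if "(Suc a, b, c) \<in> ?join (I, K)" for a b c
    proof (cases c)
      case 0
      then show ?thesis using that K(2)[of a b] unfolding 0 join_iff by simp
    next
      case (Suc c')
      then show ?thesis using that I(2)[of a b c'] unfolding Suc join_iff by simp
    qed
    moreover have "(Suc a, b, c) \<in> ?join (I, K)" if "(a, Suc b, c) \<in> ?join (I, K)" for a b c
    proof (cases c)
      case 0
      then show ?thesis using that K(3)[of a b] unfolding 0 join_iff by simp
    next
      case (Suc c')
      then show ?thesis using that I(3)[of a b c'] unfolding Suc join_iff by simp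
    qed
    ultimately show "?join IK \<in> tower (Suc M)"
      unfolding IK(1) by (rule towerI)
  next
    fix I assume I: "I \<in> tower (Suc M)"
    have "p \<in> ?join ({(a, b, c). (a, b, Suc c) \<in> I}, {(a, b). (a, b, 0) \<in> I}) \<longleftrightarrow> p \<in> I" for p
    proof (cases p)
      case (fields a b c)
      show ?thesis
      proof (cases c)
        case 0
        show ?thesis unfolding fields 0 join_iff by simp
      next
        case (Suc c')
        show ?thesis unfolding fields Suc join_iff by simp
      qed
    qed
    then show "?join ({(a, b, c). (a, b, Suc c) \<in> I}, {(a, b). (a, b, 0) \<in> I}) = I"
      by blast
    have "{(a, b, c). (a, b, Suc c) \<in> I} \<in> tower M"
    proof (rule towerI; unfold mem_Collect_eq prod.case)
      show "a + b + c < M" if "(a, b, Suc c) \<in> I" for a b c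
        using tower_bound[OF I that] by simp
    qed (fact tower_left[OF I] tower_down[OF I])+
    moreover have "{(a, b). (a, b, 0) \<in> I} \<in> stair (Suc M)"
    proof (rule stairI; unfold mem_Collect_eq prod.case)
      show "a + b < Suc M" if "(a, b, 0) \<in> I" for a b
        using tower_bound[OF I that] by simp
    qed (fact tower_left[OF I] tower_down[OF I])+
    ultimately show "({(a, b, c). (a, b, Suc c) \<in> I}, {(a, b). (a, b, 0) \<in> I}) \<in> tower M \<times> stair (Suc M)"
      by blast
  qed
  finally show ?thesis
    by (simp add: ideal_gf_def)
qed

lemma ideal_gf_tower: "ideal_gf (tower M) = (\<Prod>j\<le>M. \<Prod>d = 1..j. 1 + monom 1 d)"
proof (induction M)
  case 0
  have "tower 0 = {{}}"
    using tower_subset[of _ 0] by (auto intro!: towerI)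
  then show ?case by (simp add: ideal_gf_def)
qed (simp add: ideal_gf_tower_Suc ideal_gf_stair)

section \<open>Vandermonde determinants\<close>

lemma det_first_column_unit:
  fixes A :: "'a :: comm_ring_1 mat"
  assumes A: "A \<in> carrier_mat (Suc n) (Suc n)"
    and "A $$ (0, 0) = 1" and zero: "\<And>i. 0 < i \<Longrightarrow> i \<le> n \<Longrightarrow> A $$ (i, 0) = 0"
  shows "det A = det (mat n n (\<lambda>(i, j). A $$ (Suc i, Suc j)))"
proof -
  have "det A = (\<Sum>i<Suc n. A $$ (i, 0) * cofactor A i 0)"
    by (rule laplace_expansion_column[OF A]) simp
  also have "\<dots> = cofactor A 0 0"
    using assms by (subst sum.remove[of _ 0]) auto
  also have "mat_delete A 0 0 = mat n n (\<lambda>(i, j). A $$ (Suc i, Suc j))"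
    using A by (intro eq_matI) (auto simp: mat_delete_def)
  then have "cofactor A 0 0 = det (mat n n (\<lambda>(i, j). A $$ (Suc i, Suc j)))"
    by (simp add: cofactor_def)
  finally show ?thesis .
qed

definition vandermonde :: "nat \<Rightarrow> (nat \<Rightarrow> 'a :: comm_ring_1) \<Rightarrow> 'a mat" where
  "vandermonde n x = mat n n (\<lambda>(i, j). x i ^ j)"

text \<open>Subtracting from each row its predecessor, that is, multiplying by the unimodular
  bidiagonal \<open>L\<close>, makes column 0 a unit vector. The remaining differences are what
  telescoping geometric sums produce in \<open>gt_sum_det\<close>.\<close>

lemma det_vandermonde_differences:
  fixes x :: "nat \<Rightarrow> 'a :: idom"
  shows "det (vandermonde (Suc n) x)
    = det (mat n n (\<lambda>(i, j). x (Suc i) ^ Suc j - x i ^ Suc j))"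
proof -
  let ?N = "Suc n"
  define L :: "'a mat" where
    "L = mat ?N ?N (\<lambda>(i, k). (if k = i then 1 else 0) - (if 0 < i \<and> k = i - 1 then 1 else 0))"
  have L: "L \<in> carrier_mat ?N ?N" and V: "vandermonde ?N x \<in> carrier_mat ?N ?N"
    by (simp_all add: L_def vandermonde_def)
  have "det L = prod_list (diag_mat L)"
    by (rule det_lower_triangular[OF _ L]) (auto simp: L_def)
  also have "\<dots> = 1"
    unfolding prod_list_diag_prod by (rule prod.neutral) (auto simp: L_def)
  finally have det_L: "det L = 1" .
  have entry: "(L * vandermonde ?N x) $$ (i, j) = x i ^ j - (if 0 < i then x (i - 1) ^ j else 0)"
    if "i < ?N" "j < ?N" for i j
  proof -
    have "(L * vandermonde ?N x) $$ (i, j)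
        = (\<Sum>k = 0..<?N. ((if k = i then 1 else 0) - (if 0 < i \<and> k = i - 1 then 1 else 0)) * x k ^ j)"
      using that by (auto simp: L_def vandermonde_def scalar_prod_def simp del: sum.op_ivl_Suc intro!: sum.cong)
    \<comment> \<open>The test \<open>0 < i\<close> moves into the summand so that each sum selects
      a single index; for \<open>i = 0\<close> the index \<open>i - 1\<close> is 0 and the selected
      term vanishes.\<close>
    also have "\<dots> = (\<Sum>k = 0..<?N. (if k = i then x k ^ j else 0))
        - (\<Sum>k = 0..<?N. if k = i - 1 then (if 0 < i then x k ^ j else 0) else 0)"
      unfolding sum_subtractf[symmetric] by (rule sum.cong) auto
    also have "\<dots> = x i ^ j - (if 0 < i then x (i - 1) ^ j else 0)"
      using that by (simp only: sum.delta finite_atLeastLessThan) auto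
    finally show ?thesis .
  qed
  have "det (vandermonde ?N x) = det (L * vandermonde ?N x)"
    by (simp add: det_mult[OF L V] det_L)
  also have "\<dots> = det (mat n n (\<lambda>(i, j). (L * vandermonde ?N x) $$ (Suc i, Suc j)))"
    by (rule det_first_column_unit) (use L V entry in \<open>auto simp del: index_mult_mat(1)\<close>)
  also have "\<dots> = det (mat n n (\<lambda>(i, j). x (Suc i) ^ Suc j - x i ^ Suc j))"
    by (rule arg_cong[of _ _ det], rule eq_matI) (auto simp: entry simp del: index_mult_mat(1))
  finally show ?thesis .
qed

text \<open>Subtracting \<open>x 0\<close> times the previous column from each column makes row 0 a
  unit vector and leaves the factor \<open>x (Suc i) - x 0\<close> in row \<open>Suc i\<close>.
  These factors are collected in the diagonal matrix \<open>D\<close>.\<close>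

lemma det_vandermonde_Suc:
  fixes x :: "nat \<Rightarrow> 'a :: idom"
  shows "det (vandermonde (Suc n) x)
    = (\<Prod>i<n. x (Suc i) - x 0) * det (vandermonde n (\<lambda>i. x (Suc i)))"
proof -
  let ?N = "Suc n" and ?V = "vandermonde n (\<lambda>i. x (Suc i))"
  define U :: "'a mat" where
    "U = mat ?N ?N (\<lambda>(k, j). (if k = j then 1 else 0) - (if 0 < j \<and> k = j - 1 then x 0 else 0))"
  define D :: "'a mat" where "D = mat n n (\<lambda>(i, j). if i = j then x (Suc i) - x 0 else 0)"
  have U: "U \<in> carrier_mat ?N ?N" and V: "vandermonde ?N x \<in> carrier_mat ?N ?N"
    and D: "D \<in> carrier_mat n n" and V': "?V \<in> carrier_mat n n"
    by (simp_all add: U_def D_def vandermonde_def)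
  have "det U = prod_list (diag_mat U)"
    by (rule det_upper_triangular[OF _ U]) (auto simp: U_def upper_triangular_def)
  also have "\<dots> = 1"
    unfolding prod_list_diag_prod by (rule prod.neutral) (auto simp: U_def)
  finally have det_U: "det U = 1" .
  have "det D = prod_list (diag_mat D)"
    by (rule det_upper_triangular[OF _ D]) (auto simp: D_def upper_triangular_def)
  also have "\<dots> = (\<Prod>i<n. x (Suc i) - x 0)"
    unfolding prod_list_diag_prod by (rule prod.cong) (auto simp: D_def)
  finally have det_D: "det D = (\<Prod>i<n. x (Suc i) - x 0)" .
  let ?W = "vandermonde ?N x * U"
  have entry: "?W $$ (i, j) = (if j = 0 then 1 else x i ^ (j - 1) * (x i - x 0))"
    if "i < ?N" "j < ?N" for i j
  proof -
    have "?W $$ (i, j)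
        = (\<Sum>k = 0..<?N. x i ^ k * ((if k = j then 1 else 0) - (if 0 < j \<and> k = j - 1 then x 0 else 0)))"
      using that by (auto simp: U_def vandermonde_def scalar_prod_def simp del: sum.op_ivl_Suc intro!: sum.cong)
    also have "\<dots> = (\<Sum>k = 0..<?N. (if k = j then x i ^ k else 0))
        - (\<Sum>k = 0..<?N. if k = j - 1 then (if 0 < j then x i ^ k * x 0 else 0) else 0)"
      unfolding sum_subtractf[symmetric] by (rule sum.cong) (auto simp: algebra_simps)
    also have "\<dots> = x i ^ j - (if 0 < j then x i ^ (j - 1) * x 0 else 0)"
      using that by (simp only: sum.delta finite_atLeastLessThan) auto
    also have "\<dots> = (if j = 0 then 1 else x i ^ (j - 1) * (x i - x 0))"
      by (cases j) (auto simp: algebra_simps)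
    finally show ?thesis .
  qed
  have W: "?W \<in> carrier_mat ?N ?N"
    using U V by simp
  have "det (vandermonde ?N x) = det ?W"
    by (simp add: det_mult[OF V U] det_U)
  \<comment> \<open>Transposition turns the unit row into the unit column that
    \<open>det_first_column_unit\<close> expects.\<close>
  also have "\<dots> = det (transpose_mat ?W)"
    by (rule det_transpose[OF W, symmetric])
  also have "\<dots> = det (mat n n (\<lambda>(i, j). transpose_mat ?W $$ (Suc i, Suc j)))"
    by (rule det_first_column_unit) (use W U V entry in \<open>auto simp del: index_mult_mat(1)\<close>)
  also have "\<dots> = det (transpose_mat (D * ?V))"
  proof (rule arg_cong[of _ _ det], rule eq_matI)
    fix i j assume "i < dim_row (transpose_mat (D * ?V))" "j < dim_col (transpose_mat (D * ?V))"
    then have ij: "i < n" "j < n"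
      using D V' by auto
    have "(D * ?V) $$ (j, i) = (\<Sum>k = 0..<n. (if j = k then x (Suc j) - x 0 else 0) * x (Suc k) ^ i)"
      using ij by (auto simp: D_def vandermonde_def scalar_prod_def intro!: sum.cong)
    also have "\<dots> = (\<Sum>k = 0..<n. if k = j then (x (Suc j) - x 0) * x (Suc k) ^ i else 0)"
      by (rule sum.cong) auto
    also have "\<dots> = (x (Suc j) - x 0) * x (Suc j) ^ i"
      using ij by (simp only: sum.delta finite_atLeastLessThan) auto
    finally have "(D * ?V) $$ (j, i) = (x (Suc j) - x 0) * x (Suc j) ^ i" .
    moreover have "?W $$ (Suc j, Suc i) = x (Suc j) ^ i * (x (Suc j) - x 0)"
      using ij by (simp add: entry del: index_mult_mat(1))
    ultimately show "mat n n (\<lambda>(i, j). transpose_mat ?W $$ (Suc i, Suc j)) $$ (i, j)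
        = transpose_mat (D * ?V) $$ (i, j)"
      using ij W U V D V' by (simp add: mult.commute del: index_mult_mat(1))
  qed (use D V' in auto)
  also have "\<dots> = det D * det ?V"
    using det_transpose[of "D * ?V" n] det_mult[OF D V'] D V' by simp
  finally show ?thesis
    by (simp only: det_D)
qed

lemma det_vandermonde:
  fixes x :: "nat \<Rightarrow> 'a :: idom"
  shows "det (vandermonde n x) = (\<Prod>j<n. \<Prod>i<j. x j - x i)"
proof (induction n arbitrary: x)
  case 0
  then show ?case by (simp add: vandermonde_def)
next
  case (Suc n)
  have "(\<Prod>j<Suc n. \<Prod>i<j. x j - x i) = (\<Prod>j<n. \<Prod>i<Suc j. x (Suc j) - x i)"
    by (subst prod.lessThan_Suc_shift) simp
  also have "\<dots> = (\<Prod>j<n. (x (Suc j) - x 0) * (\<Prod>i<j. x (Suc j) - x (Suc i)))"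
    by (simp only: prod.lessThan_Suc_shift)
  finally show ?case
    by (simp add: det_vandermonde_Suc Suc.IH prod.distrib)
qed

section \<open>Gelfand-Tsetlin sums\<close>

abbreviation (input) q_pow :: "nat \<Rightarrow> int poly" where
  "q_pow d \<equiv> monom 1 d"

text \<open>The top row \<open>b\<close> is read at the indices 0 to \<open>K\<close>, and the
  weight is the sum of all entries below it. Half-open intervals make the lower rows strict:
  \<open>c j < b (Suc j) \<le> c (Suc j)\<close>.\<close>

fun gt_sum :: "nat \<Rightarrow> (nat \<Rightarrow> nat) \<Rightarrow> int poly" where
  "gt_sum 0 b = 1"
| "gt_sum (Suc K) b = (\<Sum>c\<in>PiE {..<Suc K} (\<lambda>j. {b j..<b (Suc j)}). q_pow (\<Sum>j<Suc K. c j) * gt_sum K c)"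

lemma q_pow_0: "q_pow 0 = 1"
  by (simp add: monom_0 one_pCons)

lemma q_pow_add: "q_pow (a + b) = q_pow a * q_pow b"
  by (simp add: mult_monom)

lemma q_pow_sum: "q_pow (\<Sum>i\<in>A. f i) = (\<Prod>i\<in>A. q_pow (f i))"
  by (induction A rule: infinite_finite_induct) (simp_all add: q_pow_0 q_pow_add)

lemma q_pow_mult: "q_pow (a * b) = q_pow a ^ b"
  by (simp add: monom_power mult.commute)

lemma sum_q_pow_telescope:
  assumes "a \<le> b"
  shows "(\<Sum>x = a..<b. q_pow (x * m)) * (q_pow m - 1) = q_pow (b * m) - q_pow (a * m)"
proof -
  have "(\<Sum>x = a..<b. q_pow (x * m)) * (q_pow m - 1) = (\<Sum>x = a..<b. q_pow (Suc x * m) - q_pow (x * m))"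
    by (simp add: sum_distrib_right right_diff_distrib mult_monom add.commute flip: sum_subtractf)
  also have "\<dots> = q_pow (b * m) - q_pow (a * m)"
    using assms by (rule sum_Suc_diff')
  finally show ?thesis .
qed

text \<open>Expanding the determinant of the row below by permutations turns the sum over that row
  into products of geometric sums. Multiplied by the new factors \<open>q_pow d - 1\<close>, they
  telescope to the entries of the difference matrix of the longer Vandermonde determinant.\<close>

lemma gt_sum_det:
  assumes "\<And>j. j < K \<Longrightarrow> b j \<le> b (Suc j)"
  shows "gt_sum K b * (\<Prod>j\<le>K. \<Prod>d = 1..j. q_pow d - 1) = det (vandermonde (Suc K) (\<lambda>i. q_pow (b i)))"
  using assms
proof (induction K arbitrary: b)
  case 0
  have "vandermonde (Suc 0) (\<lambda>i. q_pow (b i)) = 1\<^sub>m 1"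
    by (rule eq_matI) (auto simp: vandermonde_def)
  then show ?case by simp
next
  case (Suc K)
  let ?n = "Suc K"
  let ?P = "{p. p permutes {0..<?n}}" and ?C = "PiE {..<?n} (\<lambda>j. {b j..<b (Suc j)})"
  define w where "w = (\<Prod>j\<le>K. \<Prod>d = 1..j. q_pow d - 1)"
  have less: "p i < ?n" if "p permutes {0..<?n}" "i < ?n" for p i
    using permutes_in_image[OF that(1), of i] that(2) by simp
  \<comment> \<open>The weight of row \<open>c\<close> raises each exponent \<open>p i\<close> to
    \<open>Suc (p i)\<close>, so the exponents run over 1 to \<open>?n\<close>, matching the factors
    \<open>q_pow d - 1\<close>.\<close>
  have step: "q_pow (\<Sum>j<?n. c j) * (gt_sum K c * w)
      = (\<Sum>p\<in>?P. signof p * (\<Prod>i<?n. q_pow (c i * Suc (p i))))" if c: "c \<in> ?C" for c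
  proof -
    have "c j \<le> c (Suc j)" if "j < K" for j
    proof -
      have "c j \<in> {b j..<b (Suc j)}" "c (Suc j) \<in> {b (Suc j)..<b (Suc (Suc j))}"
        using that by (auto intro!: PiE_mem[OF c] simp del: atLeastLessThan_iff)
      then show ?thesis by simp
    qed
    then have "gt_sum K c * w = det (vandermonde ?n (\<lambda>i. q_pow (c i)))"
      unfolding w_def by (rule Suc.IH)
    also have "\<dots> = (\<Sum>p\<in>?P. signof p * (\<Prod>i<?n. q_pow (c i * p i)))"
      by (subst det_def'[of _ ?n]) (auto simp: vandermonde_def q_pow_mult less simp flip: atLeast0LessThan
          simp del: prod.op_ivl_Suc intro!: sum.cong prod.cong)
    finally show ?thesis
      by (simp add: q_pow_sum sum_distrib_left prod.distrib mult_monom mult_ac flip: prod.distrib del: prod.lessThan_Suc sum.lessThan_Suc)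
  qed
  have w': "(\<Prod>j\<le>?n. \<Prod>d = 1..j. q_pow d - 1) = w * (\<Prod>d = 1..?n. q_pow d - 1)"
    by (simp add: w_def)
  have "gt_sum ?n b * (\<Prod>j\<le>?n. \<Prod>d = 1..j. q_pow d - 1)
      = (\<Sum>c\<in>?C. q_pow (\<Sum>j<?n. c j) * (gt_sum K c * w)) * (\<Prod>d = 1..?n. q_pow d - 1)"
    unfolding w' gt_sum.simps by (simp only: sum_distrib_right mult.assoc)
  also have "\<dots> = (\<Sum>c\<in>?C. \<Sum>p\<in>?P. signof p * (\<Prod>i<?n. q_pow (c i * Suc (p i)))) * (\<Prod>d = 1..?n. q_pow d - 1)"
    by (simp only: step cong: sum.cong)
  also have "\<dots> = (\<Sum>p\<in>?P. signof p * (\<Sum>c\<in>?C. \<Prod>i<?n. q_pow (c i * Suc (p i))) * (\<Prod>d = 1..?n. q_pow d - 1))"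
    by (subst sum.swap) (simp only: sum_distrib_right sum_distrib_left)
  also have "\<dots> = (\<Sum>p\<in>?P. signof p *
      (\<Prod>i<?n. q_pow (b (Suc i) * Suc (p i)) - q_pow (b i * Suc (p i))))"
  proof (rule sum.cong[OF refl])
    fix p assume "p \<in> ?P"
    then have p: "p permutes {..<?n}"
      by (simp add: atLeast0LessThan)
    \<comment> \<open>Permuting the factors by \<open>p\<close> pairs the geometric sum of ratio
      \<open>q_pow (Suc (p i))\<close> with the factor that makes it telescope.\<close>
    have "(\<Prod>d = 1..?n. q_pow d - 1) = (\<Prod>i<?n. q_pow (Suc i) - 1)"
      by (rule prod.reindex_bij_witness[of _ Suc "\<lambda>d. d - 1"]) auto
    also have "\<dots> = (\<Prod>i<?n. q_pow (Suc (p i)) - 1)"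
      using prod.permute[OF p, of "\<lambda>i. q_pow (Suc i) - 1"] by (simp add: o_def)
    finally have "(\<Sum>c\<in>?C. \<Prod>i<?n. q_pow (c i * Suc (p i))) * (\<Prod>d = 1..?n. q_pow d - 1)
        = (\<Prod>i<?n. \<Sum>x = b i..<b (Suc i). q_pow (x * Suc (p i))) * (\<Prod>i<?n. q_pow (Suc (p i)) - 1)"
      by (simp only: prod_sum_PiE finite_lessThan finite_atLeastLessThan)
    also have "\<dots> = (\<Prod>i<?n. q_pow (b (Suc i) * Suc (p i)) - q_pow (b i * Suc (p i)))"
      unfolding prod.distrib[symmetric]
      by (rule prod.cong[OF refl], rule sum_q_pow_telescope, rule Suc.prems) simp
    finally show "signof p * (\<Sum>c\<in>?C. \<Prod>i<?n. q_pow (c i * Suc (p i))) * (\<Prod>d = 1..?n. q_pow d - 1)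
        = signof p * (\<Prod>i<?n. q_pow (b (Suc i) * Suc (p i)) - q_pow (b i * Suc (p i)))"
      by (simp only: mult.assoc)
  qed
  also have "\<dots> = det (mat ?n ?n (\<lambda>(i, j). q_pow (b (Suc i)) ^ Suc j - q_pow (b i) ^ Suc j))"
    by (subst det_def'[of _ ?n]) (auto simp: q_pow_mult[symmetric] less simp flip: atLeast0LessThan
        simp del: prod.op_ivl_Suc mult_Suc_right power_Suc intro!: sum.cong prod.cong)
  also have "\<dots> = det (vandermonde (Suc ?n) (\<lambda>i. q_pow (b i)))"
    by (rule det_vandermonde_differences[symmetric])
  finally show ?case .
qed

text \<open>Each difference of the top row factors as q^(2j) - q^(2i) = q^(2i) (1 + q^(j-i))
  (q^(j-i) - 1). The last factors multiply to the denominator \<open>w\<close> of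
  \<open>gt_sum_det\<close>, which is nonzero and cancels. The leading monomial is the weight of the
  entrywise smallest pattern.\<close>

lemma gt_sum_even:
  "gt_sum K (\<lambda>j. 2 * j) = q_pow (\<Sum>j<K. \<Sum>i\<le>j. 2 * i) * (\<Prod>j\<le>K. \<Prod>d = 1..j. 1 + q_pow d)"
proof -
  define w where "w = (\<Prod>j\<le>K. \<Prod>d = 1..j. q_pow d - 1)"
  have "q_pow d \<noteq> 1" if "1 \<le> d" for d
    using that by (metis degree_1 degree_monom_eq not_one_le_zero zero_neq_one)
  then have "w \<noteq> 0"
    by (simp add: w_def)
  have "gt_sum K (\<lambda>j. 2 * j) * w = (\<Prod>j<Suc K. \<Prod>i<j. q_pow (2 * j) - q_pow (2 * i))"
    unfolding w_def by (simp only: gt_sum_det det_vandermonde mult_le_mono2 le_SucI order.refl)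
  also have "\<dots> = (\<Prod>j\<le>K. q_pow (\<Sum>i<j. 2 * i) * ((\<Prod>d = 1..j. 1 + q_pow d) * (\<Prod>d = 1..j. q_pow d - 1)))"
    unfolding lessThan_Suc_atMost
  proof (rule prod.cong[OF refl])
    fix j
    have "(\<Prod>i<j. q_pow (2 * j) - q_pow (2 * i))
        = (\<Prod>i<j. q_pow (2 * i) * ((1 + q_pow (j - i)) * (q_pow (j - i) - 1)))"
      by (rule prod.cong) (auto simp: algebra_simps mult_monom simp flip: mult_2)
    also have "\<dots> = q_pow (\<Sum>i<j. 2 * i) * (\<Prod>i<j. (1 + q_pow (j - i)) * (q_pow (j - i) - 1))"
      unfolding q_pow_sum by (rule prod.distrib)
    also have "(\<Prod>i<j. (1 + q_pow (j - i)) * (q_pow (j - i) - 1)) = (\<Prod>d = 1..j. (1 + q_pow d) * (q_pow d - 1))"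
      by (rule prod.reindex_bij_witness[of _ "\<lambda>d. j - d" "\<lambda>i. j - i"]) auto
    finally show "(\<Prod>i<j. q_pow (2 * j) - q_pow (2 * i))
        = q_pow (\<Sum>i<j. 2 * i) * ((\<Prod>d = 1..j. 1 + q_pow d) * (\<Prod>d = 1..j. q_pow d - 1))"
      by (simp only: prod.distrib)
  qed
  also have "\<dots> = q_pow (\<Sum>j\<le>K. \<Sum>i<j. 2 * i) * (\<Prod>j\<le>K. \<Prod>d = 1..j. 1 + q_pow d) * w"
    by (simp add: prod.distrib q_pow_sum w_def mult.assoc)
  \<comment> \<open>The term for \<open>j = 0\<close> is empty, so the outer index shifts by
    one.\<close>
  also have "(\<Sum>j\<le>K. \<Sum>i<j. 2 * i) = (\<Sum>j<K. \<Sum>i\<le>j. 2 * i :: nat)"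
    by (simp add: lessThan_Suc_atMost[symmetric] sum.lessThan_Suc_shift del: sum.lessThan_Suc)
  finally show ?thesis
    using \<open>w \<noteq> 0\<close> by simp
qed

section \<open>Zigzags\<close>

text \<open>Row \<open>k\<close> of a pattern has the entries \<open>b\<^sub>k 0, \<dots>, b\<^sub>k k\<close> with
  \<open>b\<^sub>k\<^sub>+\<^sub>1 j \<le> b\<^sub>k j < b\<^sub>k\<^sub>+\<^sub>1 (j + 1)\<close>; it is encoded by the points \<open>(k, j, x)\<close> with
  \<open>2 j \<le> x < b\<^sub>k j\<close>. The set below encodes the rows \<open>0, \<dots>, K - 1\<close> of the patterns with row
  \<open>K\<close> equal to \<open>b\<close>.\<close>

definition gt_ideals :: "nat \<Rightarrow> (nat \<Rightarrow> nat) \<Rightarrow> (nat \<times> nat \<times> nat) set set" where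
  "gt_ideals K b = {I. finite I \<and> (\<forall>k j x. (k, j, x) \<in> I \<longrightarrow> j \<le> k \<and> k < K \<and> 2 * j \<le> x)
     \<and> (\<forall>k j x. (k, j, Suc x) \<in> I \<longrightarrow> 2 * j \<le> x \<longrightarrow> (k, j, x) \<in> I)
     \<and> (\<forall>k j x. (Suc k, j, x) \<in> I \<longrightarrow> j \<le> k \<longrightarrow> (k, j, x) \<in> I)
     \<and> (\<forall>k j x. (k, j, x) \<in> I \<longrightarrow> Suc k < K \<longrightarrow> Suc (2 * j) \<le> x \<longrightarrow> (Suc k, Suc j, Suc x) \<in> I)
     \<and> (\<forall>k j x. Suc k = K \<longrightarrow> j \<le> k \<longrightarrow> 2 * j \<le> x \<longrightarrow> x < b j \<longrightarrow> (k, j, x) \<in> I)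
     \<and> (\<forall>k j x. Suc k = K \<longrightarrow> (k, j, x) \<in> I \<longrightarrow> Suc x < b (Suc j))}"

lemma gt_idealsI:
  assumes "finite I" "\<And>k j x. (k, j, x) \<in> I \<Longrightarrow> j \<le> k \<and> k < K \<and> 2 * j \<le> x"
    "\<And>k j x. (k, j, Suc x) \<in> I \<Longrightarrow> 2 * j \<le> x \<Longrightarrow> (k, j, x) \<in> I"
    "\<And>k j x. (Suc k, j, x) \<in> I \<Longrightarrow> j \<le> k \<Longrightarrow> (k, j, x) \<in> I"
    "\<And>k j x. (k, j, x) \<in> I \<Longrightarrow> Suc k < K \<Longrightarrow> Suc (2 * j) \<le> x \<Longrightarrow> (Suc k, Suc j, Suc x) \<in> I"
    "\<And>k j x. Suc k = K \<Longrightarrow> j \<le> k \<Longrightarrow> 2 * j \<le> x \<Longrightarrow> x < b j \<Longrightarrow> (k, j, x) \<in> I"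
    "\<And>k j x. Suc k = K \<Longrightarrow> (k, j, x) \<in> I \<Longrightarrow> Suc x < b (Suc j)"
  shows "I \<in> gt_ideals K b"
  unfolding gt_ideals_def mem_Collect_eq
  by (intro conjI; (intro allI impI)?)
    (rule assms(1), erule assms(2), erule (1) assms(3), erule (1) assms(4), erule (2) assms(5),
      erule (3) assms(6), erule (1) assms(7))

text \<open>In terms of heights, \<open>gt_ideals_left\<close> and \<open>gt_ideals_right\<close>
  are the two interlacing inequalities between consecutive rows, and \<open>gt_ideals_lower\<close>
  and \<open>gt_ideals_upper\<close> are the same inequalities against the fixed row
  \<open>b\<close>. The bound \<open>Suc (2 * j) \<le> x\<close> keeps \<open>Suc x\<close> within
  the range of line \<open>Suc j\<close>, which starts at \<open>2 * Suc j\<close>.\<close>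

lemma
  assumes I: "I \<in> gt_ideals K b"
  shows gt_ideals_finite_mem: "finite I"
    and gt_ideals_bounds: "(k, j, x) \<in> I \<Longrightarrow> j \<le> k \<and> k < K \<and> 2 * j \<le> x"
    and gt_ideals_chain: "(k, j, Suc x) \<in> I \<Longrightarrow> 2 * j \<le> x \<Longrightarrow> (k, j, x) \<in> I"
    and gt_ideals_left: "(Suc k, j, x) \<in> I \<Longrightarrow> j \<le> k \<Longrightarrow> (k, j, x) \<in> I"
    and gt_ideals_right: "(k, j, x) \<in> I \<Longrightarrow> Suc k < K \<Longrightarrow> Suc (2 * j) \<le> x \<Longrightarrow> (Suc k, Suc j, Suc x) \<in> I"
    and gt_ideals_lower: "Suc k = K \<Longrightarrow> j \<le> k \<Longrightarrow> 2 * j \<le> x \<Longrightarrow> x < b j \<Longrightarrow> (k, j, x) \<in> I"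
    and gt_ideals_upper: "Suc k = K \<Longrightarrow> (k, j, x) \<in> I \<Longrightarrow> Suc x < b (Suc j)"
proof -
  note 1 = I[unfolded gt_ideals_def mem_Collect_eq]
  note 2 = 1[THEN conjunct2]
  note 3 = 2[THEN conjunct2]
  note 4 = 3[THEN conjunct2]
  note 5 = 4[THEN conjunct2]
  note 6 = 5[THEN conjunct2]
  show "finite I"
    by (rule 1[THEN conjunct1])
  show "j \<le> k \<and> k < K \<and> 2 * j \<le> x" if "(k, j, x) \<in> I"
    using that by (rule 2[THEN conjunct1, rule_format])
  show "(k, j, x) \<in> I" if "(k, j, Suc x) \<in> I" "2 * j \<le> x"
    using that by (rule 3[THEN conjunct1, rule_format])
  show "(k, j, x) \<in> I" if "(Suc k, j, x) \<in> I" "j \<le> k"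
    using that by (rule 4[THEN conjunct1, rule_format])
  show "(Suc k, Suc j, Suc x) \<in> I" if "(k, j, x) \<in> I" "Suc k < K" "Suc (2 * j) \<le> x"
    using that by (rule 5[THEN conjunct1, rule_format])
  show "(k, j, x) \<in> I" if "Suc k = K" "j \<le> k" "2 * j \<le> x" "x < b j"
    using that by (rule 6[THEN conjunct1, rule_format])
  show "Suc x < b (Suc j)" if "Suc k = K" "(k, j, x) \<in> I"
    using that by (rule 6[THEN conjunct2, rule_format])
qed

section \<open>Peeling off the last row of a pattern\<close>

lemma finite_interval_downset:
  fixes A :: "nat set"
  assumes "finite A" and lower: "\<And>x. x \<in> A \<Longrightarrow> a \<le> x"
    and down: "\<And>x. Suc x \<in> A \<Longrightarrow> a \<le> x \<Longrightarrow> x \<in> A"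
  shows "A = {a..<a + card A}"
proof (cases "A = {}")
  case False
  define m where "m = Max A"
  have m: "m \<in> A" "\<And>x. x \<in> A \<Longrightarrow> x \<le> m"
    using False assms(1) by (auto simp: m_def)
  have "x \<in> A" if "a \<le> x" "x \<le> m" for x
    using that(2,1) by (induction rule: inc_induct) (use m(1) down in auto)
  then have "A = {a..m}"
    using m(2) lower by (meson atLeastAtMost_iff subsetI subset_antisym)
  then show ?thesis
    using lower[OF m(1)] by auto
qed simp

definition level :: "nat \<Rightarrow> (nat \<Rightarrow> nat) \<Rightarrow> (nat \<times> nat \<times> nat) set" where
  "level K c = {K} \<times> (SIGMA j : {..<Suc K}. {2 * j..<c j})"

lemma level_iff: "(k, j, x) \<in> level K c \<longleftrightarrow> k = K \<and> j \<le> K \<and> 2 * j \<le> x \<and> x < c j"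
  by (auto simp: level_def)

lemma finite_level: "finite (level K c)"
  unfolding level_def by (intro finite_cartesian_product finite_SigmaI) auto

lemma card_level: "card (level K c) = (\<Sum>j<Suc K. c j - 2 * j)"
  unfolding level_def by (simp add: card_cartesian_product card_SigmaI del: sum.lessThan_Suc)

text \<open>The heights on row \<open>K\<close> form the row \<open>c\<close>. The closure
  conditions between rows \<open>K - 1\<close> and \<open>K\<close> then become the boundary
  conditions of \<open>gt_ideals K c\<close>. The inverse \<open>f'\<close> reads off the heights
  and discards row \<open>K\<close>.\<close>

lemma gt_ideals_Suc_bij:
  assumes b: "\<And>j. j \<le> Suc K \<Longrightarrow> 2 * j \<le> b j"
  shows "bij_betw (\<lambda>(c, I). level K c \<union> I)
    (SIGMA c : PiE {..<Suc K} (\<lambda>j. {b j..<b (Suc j)}). gt_ideals K c) (gt_ideals (Suc K) b)"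
proof -
  let ?A = "SIGMA c : PiE {..<Suc K} (\<lambda>j. {b j..<b (Suc j)}). gt_ideals K c"
  define ht where "ht I j = 2 * j + card {x. (K, j, x) \<in> I}" for I :: "(nat \<times> nat \<times> nat) set" and j
  define f' where "f' I = (restrict (ht I) {..<Suc K}, {p \<in> I. fst p < K})" for I :: "(nat \<times> nat \<times> nat) set"
  have ht_ge: "2 * j \<le> ht I j" for I j
    by (simp add: ht_def)
  have ht_iff: "(K, j, x) \<in> I \<longleftrightarrow> 2 * j \<le> x \<and> x < ht I j" if I: "I \<in> gt_ideals (Suc K) b" for I j x
  proof -
    \<comment> \<open>Every line of an ideal is an interval starting at \<open>2 * j\<close>, so its
      cardinality determines it.\<close>
    have "{x. (K, j, x) \<in> I} = {2 * j..<2 * j + card {x. (K, j, x) \<in> I}}"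
    proof (rule finite_interval_downset)
      have "inj (\<lambda>x. (K, j, x))"
        by (simp add: inj_on_def)
      with gt_ideals_finite_mem[OF I] have "finite ((\<lambda>x. (K, j, x)) -` I)"
        by (rule finite_vimageI)
      then show "finite {x. (K, j, x) \<in> I}"
        unfolding vimage_def .
      show "2 * j \<le> x" if "x \<in> {x. (K, j, x) \<in> I}" for x
        using gt_ideals_bounds[OF I, of K j x] that by simp
      show "x \<in> {x. (K, j, x) \<in> I}" if "Suc x \<in> {x. (K, j, x) \<in> I}" "2 * j \<le> x" for x
        using gt_ideals_chain[OF I, of K j x] that by simp
    qed
    from arg_cong[OF this, of "\<lambda>A. x \<in> A"] show ?thesis
      by (simp only: ht_def mem_Collect_eq atLeastLessThan_iff)
  qed
  have bij_image: "f' I \<in> ?A" if I: "I \<in> gt_ideals (Suc K) b" for I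
  proof -
    have "b j \<le> ht I j" if "j \<le> K" for j
    proof (rule ccontr)
      assume "\<not> b j \<le> ht I j"
      then have "(K, j, ht I j) \<in> I"
        using gt_ideals_lower[OF I, of K j "ht I j"] ht_ge[of j I] that by simp
      then show False
        by (simp add: ht_iff[OF I])
    qed
    \<comment> \<open>An empty line has no top point to which \<open>gt_ideals_upper\<close>
      applies; there the assumption \<open>2 * Suc j \<le> b (Suc j)\<close> gives the
      bound.\<close>
    moreover have "ht I j < b (Suc j)" if "j \<le> K" for j
    proof (cases "ht I j = 2 * j")
      case True
      then show ?thesis using b[of "Suc j"] that by simp
    next
      case False
      then have "(K, j, ht I j - 1) \<in> I"
        using ht_ge[of j I] by (auto simp: ht_iff[OF I])
      then show ?thesis
        using gt_ideals_upper[OF I refl, of j "ht I j - 1"] False ht_ge[of j I] by simp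
    qed
    ultimately have "restrict (ht I) {..<Suc K} \<in> PiE {..<Suc K} (\<lambda>j. {b j..<b (Suc j)})"
      by (simp add: PiE_iff)
    moreover have "{p \<in> I. fst p < K} \<in> gt_ideals K (restrict (ht I) {..<Suc K})"
    proof (rule gt_idealsI; (unfold mem_Collect_eq fst_conv)?)
      show "finite {p \<in> I. fst p < K}"
        using gt_ideals_finite_mem[OF I] by simp
      fix k j x
      show "j \<le> k \<and> k < K \<and> 2 * j \<le> x" if "(k, j, x) \<in> I \<and> k < K"
        using gt_ideals_bounds[OF I, of k j x] that by simp
      show "(k, j, x) \<in> I \<and> k < K" if "(k, j, Suc x) \<in> I \<and> k < K" "2 * j \<le> x"
        using gt_ideals_chain[OF I, of k j x] that by simp
      show "(k, j, x) \<in> I \<and> k < K" if "(Suc k, j, x) \<in> I \<and> Suc k < K" "j \<le> k"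
        using gt_ideals_left[OF I, of k j x] that by simp
      show "(Suc k, Suc j, Suc x) \<in> I \<and> Suc k < K" if "(k, j, x) \<in> I \<and> k < K" "Suc k < K" "Suc (2 * j) \<le> x"
        using gt_ideals_right[OF I, of k j x] that by simp
      show "(k, j, x) \<in> I \<and> k < K" if "Suc k = K" "j \<le> k" "2 * j \<le> x" "x < restrict (ht I) {..<Suc K} j"
        using gt_ideals_left[OF I, of k j x] that ht_iff[OF I, of j x] by auto
      show "Suc x < restrict (ht I) {..<Suc K} (Suc j)" if "Suc k = K" "(k, j, x) \<in> I \<and> k < K"
      proof -
        have jk: "j \<le> k" "2 * j \<le> x"
          using gt_ideals_bounds[OF I, of k j x] that by simp_all
        have "Suc x < ht I (Suc j)"
        \<comment> \<open>At the lowest point of a line, \<open>gt_ideals_right\<close> says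
          nothing, but \<open>Suc x\<close> already lies below the start \<open>2 * Suc j\<close> of
          the next line.\<close>
        proof (cases "x = 2 * j")
          case False
          then have "(Suc k, Suc j, Suc x) \<in> I"
            using gt_ideals_right[OF I, of k j x] that jk by simp
          then show ?thesis
            using that ht_iff[OF I, of "Suc j" "Suc x"] by simp
        qed (use ht_ge[of "Suc j" I] in simp)
        then show ?thesis
          using jk that by simp
      qed
    qed
    ultimately show ?thesis
      by (simp add: f'_def)
  qed
  have bij_preimage: "level K c \<union> I \<in> gt_ideals (Suc K) b"
    if c: "c \<in> PiE {..<Suc K} (\<lambda>j. {b j..<b (Suc j)})" and I: "I \<in> gt_ideals K c" for c I
  proof -
    have cb: "b j \<le> c j \<and> c j < b (Suc j)" if "j \<le> K" for j
      using c that by (auto simp: PiE_iff)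
    show ?thesis
    proof (rule gt_idealsI; (unfold Un_iff level_iff)?)
      show "finite (level K c \<union> I)"
        using gt_ideals_finite_mem[OF I] finite_level by simp
      fix k j x
      let ?in = "\<lambda>k j x. (k = K \<and> j \<le> K \<and> 2 * j \<le> x \<and> x < c j) \<or> (k, j, x) \<in> I"
      show "j \<le> k \<and> k < Suc K \<and> 2 * j \<le> x" if "?in k j x"
        using gt_ideals_bounds[OF I, of k j x] that by auto
      show "?in k j x" if "?in k j (Suc x)" "2 * j \<le> x"
        using gt_ideals_chain[OF I, of k j x] that by auto
      show "?in k j x" if "?in (Suc k) j x" "j \<le> k"
        using gt_ideals_left[OF I, of k j x] gt_ideals_lower[OF I, of k j x] that by auto
      show "?in (Suc k) (Suc j) (Suc x)" if "?in k j x" "Suc k < Suc K" "Suc (2 * j) \<le> x"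
        using gt_ideals_bounds[OF I, of k j x] gt_ideals_right[OF I, of k j x]
          gt_ideals_upper[OF I, of k j x] that by (cases "Suc k = K") auto
      show "?in k j x" if "Suc k = Suc K" "j \<le> k" "2 * j \<le> x" "x < b j"
        using cb[of j] that by simp
      show "Suc x < b (Suc j)" if "Suc k = Suc K" "?in k j x"
        using cb[of j] gt_ideals_bounds[OF I, of k j x] that by auto
    qed
  qed
  have inverse: "f' (level K c \<union> I) = (c, I)"
    if c: "c \<in> PiE {..<Suc K} (\<lambda>j. {b j..<b (Suc j)})" and I: "I \<in> gt_ideals K c" for c I
  proof -
    have "{x. (K, j, x) \<in> level K c \<union> I} = {2 * j..<c j}" if "j \<le> K" for j
      using gt_ideals_bounds[OF I, of K j] that by (auto simp: level_iff)
    \<comment> \<open>Without this, an empty line would be read back with height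
      \<open>2 * j\<close> instead of \<open>c j\<close>.\<close>
    moreover have "2 * j \<le> c j" if "j \<le> K" for j
      using PiE_mem[OF c, of j] b[of j] that by simp
    ultimately have "ht (level K c \<union> I) j = c j" if "j \<le> K" for j
      using that by (simp add: ht_def)
    then have "restrict (ht (level K c \<union> I)) {..<Suc K} = c"
      using c by (intro extensionalityI[of _ "{..<Suc K}"]) (auto simp: PiE_iff)
    moreover have "p \<in> level K c \<union> I \<and> fst p < K \<longleftrightarrow> p \<in> I" for p
    proof (cases p)
      case (fields k j x)
      then show ?thesis
        using gt_ideals_bounds[OF I, of k j x] by (auto simp: level_iff)
    qed
    then have "{p \<in> level K c \<union> I. fst p < K} = I"
      by blast
    ultimately show ?thesis
      by (simp add: f'_def)
  qed
  have inverse': "level K (restrict (ht I) {..<Suc K}) \<union> {p \<in> I. fst p < K} = I"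
    if I: "I \<in> gt_ideals (Suc K) b" for I
  proof -
    have "p \<in> level K (restrict (ht I) {..<Suc K}) \<union> {p \<in> I. fst p < K} \<longleftrightarrow> p \<in> I" for p
    proof (cases p)
      case (fields k j x)
      then show ?thesis
        using gt_ideals_bounds[OF I, of k j x] ht_iff[OF I, of j x]
        by (cases "k = K") (auto simp: level_iff)
    qed
    then show ?thesis
      by blast
  qed
  show ?thesis
  proof (rule bij_betw_byWitness[of _ f'])
    show "\<forall>a\<in>?A. f' (case a of (c, I) \<Rightarrow> level K c \<union> I) = a"
      using inverse by auto
    show "\<forall>I\<in>gt_ideals (Suc K) b. (case f' I of (c, I) \<Rightarrow> level K c \<union> I) = I"
      using inverse' by (simp add: f'_def)
    show "(\<lambda>(c, I). level K c \<union> I) ` ?A \<subseteq> gt_ideals (Suc K) b"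
      using bij_preimage by auto
    show "f' ` gt_ideals (Suc K) b \<subseteq> ?A"
      using bij_image by blast
  qed
qed

lemma finite_gt_ideals:
  assumes "\<And>j. j \<le> K \<Longrightarrow> 2 * j \<le> b j"
  shows "finite (gt_ideals K b)"
  using assms
proof (induction K arbitrary: b)
  case 0
  have "gt_ideals 0 b \<subseteq> {{}}"
    using gt_ideals_bounds[of _ 0 b] by fastforce
  then show ?case
    by (rule finite_subset) simp
next
  case (Suc K)
  have "finite (SIGMA c : PiE {..<Suc K} (\<lambda>j. {b j..<b (Suc j)}). gt_ideals K c)"
  proof (rule finite_SigmaI)
    fix c assume c: "c \<in> PiE {..<Suc K} (\<lambda>j. {b j..<b (Suc j)})"
    show "finite (gt_ideals K c)"
    proof (rule Suc.IH)
      show "2 * j \<le> c j" if "j \<le> K" for j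
        using PiE_mem[OF c, of j] Suc.prems[of j] that by simp
    qed
  qed (simp add: finite_PiE)
  then show ?case
    using bij_betw_finite[OF gt_ideals_Suc_bij] Suc.prems by blast
qed

text \<open>\<open>gt_sum\<close> weighs a pattern by its entries, whereas an ideal counts only
  their excess over \<open>2 * j\<close>. The monomial adds back the total of these offsets over the
  rows below \<open>K\<close>.\<close>

lemma ideal_gf_gt_ideals:
  assumes "\<And>j. j \<le> K \<Longrightarrow> 2 * j \<le> b j"
  shows "q_pow (\<Sum>j<K. \<Sum>i\<le>j. 2 * i) * ideal_gf (gt_ideals K b) = gt_sum K b"
  using assms
proof (induction K arbitrary: b)
  case 0
  have "gt_ideals 0 b = {{}}"
    using gt_ideals_bounds[of _ 0 b] by (fastforce intro!: gt_idealsI)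
  then show ?case
    by (simp add: ideal_gf_def q_pow_0)
next
  case (Suc K)
  let ?C = "PiE {..<Suc K} (\<lambda>j. {b j..<b (Suc j)})"
  let ?e = "\<Sum>j<K. \<Sum>i\<le>j. 2 * i"
  have c_ge: "2 * j \<le> c j" if "c \<in> ?C" "j \<le> K" for c j
    using PiE_mem[OF that(1), of j] Suc.prems[of j] that(2) by simp
  have "ideal_gf (gt_ideals (Suc K) b)
      = (\<Sum>(c, I)\<in>(SIGMA c : ?C. gt_ideals K c). q_pow (card (level K c \<union> I)))"
    unfolding ideal_gf_def
    by (subst sum.reindex_bij_betw[OF gt_ideals_Suc_bij[OF Suc.prems], symmetric])
      (simp_all add: case_prod_unfold)
  also have "\<dots> = (\<Sum>c\<in>?C. \<Sum>I\<in>gt_ideals K c. q_pow (card (level K c \<union> I)))"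
    by (rule sum.Sigma[symmetric]) (auto simp: finite_PiE intro!: finite_gt_ideals c_ge)
  finally have "q_pow (\<Sum>j<Suc K. \<Sum>i\<le>j. 2 * i) * ideal_gf (gt_ideals (Suc K) b)
      = (\<Sum>c\<in>?C. \<Sum>I\<in>gt_ideals K c. q_pow ((\<Sum>j<Suc K. \<Sum>i\<le>j. 2 * i) + card (level K c \<union> I)))"
    by (simp only: sum_distrib_left q_pow_add)
  also have "\<dots> = (\<Sum>c\<in>?C. \<Sum>I\<in>gt_ideals K c. q_pow ((\<Sum>j<Suc K. c j) + (?e + card I)))"
  proof (intro sum.cong refl arg_cong[of _ _ q_pow])
    fix c I assume c: "c \<in> ?C" and I: "I \<in> gt_ideals K c"
    have "level K c \<inter> I = {}"
      using gt_ideals_bounds[OF I] by (auto simp: level_def)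
    then have "card (level K c \<union> I) = (\<Sum>j<Suc K. c j - 2 * j) + card I"
      using finite_level gt_ideals_finite_mem[OF I] by (simp only: card_Un_disjoint card_level)
    moreover have "(\<Sum>j<Suc K. c j) = (\<Sum>j<Suc K. c j - 2 * j) + (\<Sum>j<Suc K. 2 * j)"
      unfolding sum.distrib[symmetric] using c_ge[OF c] by (intro sum.cong) auto
    moreover have "(\<Sum>j<Suc K. \<Sum>i\<le>j. 2 * i) = ?e + (\<Sum>j<Suc K. 2 * j)"
      by (subst sum.lessThan_Suc) (simp only: lessThan_Suc_atMost)
    ultimately show "(\<Sum>j<Suc K. \<Sum>i\<le>j. 2 * i) + card (level K c \<union> I) = (\<Sum>j<Suc K. c j) + (?e + card I)"
      by linarith
  qed
  also have "\<dots> = (\<Sum>c\<in>?C. q_pow (\<Sum>j<Suc K. c j) * (q_pow ?e * ideal_gf (gt_ideals K c)))"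
    unfolding ideal_gf_def by (simp only: sum_distrib_left q_pow_add)
  also have "\<dots> = gt_sum (Suc K) b"
    unfolding gt_sum.simps by (rule sum.cong) (simp_all only: Suc.IH c_ge)
  finally show ?case .
qed

lemma ideal_gf_gt_ideals_even:
  "ideal_gf (gt_ideals K (\<lambda>j. 2 * j)) = (\<Prod>j\<le>K. \<Prod>d = 1..j. 1 + q_pow d)"
proof -
  have "q_pow (\<Sum>j<K. \<Sum>i\<le>j. 2 * i) * ideal_gf (gt_ideals K (\<lambda>j. 2 * j))
      = q_pow (\<Sum>j<K. \<Sum>i\<le>j. 2 * i) * (\<Prod>j\<le>K. \<Prod>d = 1..j. 1 + q_pow d)"
    using ideal_gf_gt_ideals[of K "\<lambda>j. 2 * j"] by (simp add: gt_sum_even)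
  then show ?thesis
    by (simp add: monom_eq_0_iff)
qed

section \<open>The product formulas\<close>

text \<open>The factor \<open>f d\<close> occurs once for every \<open>j\<close> from
  \<open>d\<close> to \<open>M\<close>.\<close>

lemma prod_triangle_power:
  fixes f :: "nat \<Rightarrow> 'a :: comm_monoid_mult"
  shows "(\<Prod>j\<le>M. \<Prod>d = 1..j. f d) = (\<Prod>d = 1..M. f d ^ (Suc M - d))"
proof (induction M)
  case (Suc M)
  have "(\<Prod>j\<le>Suc M. \<Prod>d = 1..j. f d) = (\<Prod>d = 1..M. f d ^ (Suc M - d)) * (\<Prod>d = 1..Suc M. f d)"
    by (simp only: prod.atMost_Suc Suc.IH)
  also have "\<dots> = (\<Prod>d = 1..M. f d ^ (Suc M - d) * f d) * f (Suc M)"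
    by (simp add: prod.distrib mult.assoc)
  also have "(\<Prod>d = 1..M. f d ^ (Suc M - d) * f d) = (\<Prod>d = 1..M. f d ^ (Suc (Suc M) - d))"
    by (rule prod.cong) (auto simp: Suc_diff_le mult.commute)
  finally show ?case
    by simp
qed simp

section \<open>q-integers, the triple product and the value at q = 1\<close>

lemma q_int_double: "q_int (j + j) = q_int j * (1 + monom 1 j)"
proof -
  have "q_int (j + j) = (\<Sum>i<j. monom 1 i) + (\<Sum>i<j. monom 1 (j + i))"
    unfolding q_int_def lessThan_atLeast0
    by (subst sum.atLeastLessThan_concat[of 0 j "j + j", symmetric])
      (simp_all add: sum.shift_bounds_nat_ivl[of _ 0 j j, simplified] add.commute)
  also have "\<dots> = q_int j * (1 + monom 1 j)"
    by (simp add: q_int_def distrib_left sum_distrib_right mult_monom add.commute)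
  finally show ?thesis .
qed

lemma q_int_nonzero:
  assumes "1 \<le> m"
  shows "q_int m \<noteq> 0"
proof
  assume "q_int m = 0"
  then have "poly (q_int m) 1 = 0"
    by simp
  with assms show False
    by (simp add: q_int_def poly_sum poly_monom)
qed

lemma to_fract_prod: "to_fract (\<Prod>i\<in>A. f i) = (\<Prod>i\<in>A. to_fract (f i))"
  by (induction A rule: infinite_finite_induct) simp_all

lemma to_fract_power: "to_fract (x ^ k) = to_fract x ^ k"
  by (induction k) simp_all

text \<open>Consecutive factors cancel and leave [2j] / [j], which \<open>q_int_double\<close>
  evaluates.\<close>

lemma prod_q_int_telescope:
  assumes "1 \<le> j"
  shows "(\<Prod>i = 1..j. to_fract (q_int (i + j)) / to_fract (q_int (i + j - 1))) = to_fract (1 + monom 1 j)"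
proof -
  have nz: "to_fract (q_int m) \<noteq> 0" if "1 \<le> m" for m
    using q_int_nonzero[OF that] by simp
  have "(\<Prod>i = 1..m. to_fract (q_int (i + j)) / to_fract (q_int (i + j - 1)))
      = to_fract (q_int (m + j)) / to_fract (q_int j)" for m
    using assms nz by (induction m) (simp_all add: field_simps)
  from this[of j] show ?thesis
    using nz[OF assms] by (simp only: q_int_double to_fract_mult) simp
qed

text \<open>The factor is independent of \<open>k\<close>, which takes \<open>n - j\<close> values
  for given \<open>j\<close>. Ordering the product by \<open>j\<close>, then \<open>k\<close>, then
  \<open>i\<close> puts the telescoping product innermost.\<close>

lemma prod_q_int_quotients:
  assumes "1 \<le> n"
  shows "(\<Prod>(i, j, k) \<in> {(i, j, k). 1 \<le> i \<and> i \<le> j \<and> j \<le> k \<and> k \<le> n - 1}.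
      to_fract (q_int (i + j)) / to_fract (q_int (i + j - 1)))
    = to_fract (\<Prod>j = 1..n-1. (1 + monom 1 j) ^ (n - j))"
proof -
  let ?f = "\<lambda>i j. to_fract (q_int (i + j)) / to_fract (q_int (i + j - 1))"
  let ?B = "SIGMA j : {1..n-1}. {j..n-1} \<times> {1..j}"
  have "(\<Prod>(i, j, k) \<in> {(i, j, k). 1 \<le> i \<and> i \<le> j \<and> j \<le> k \<and> k \<le> n - 1}. ?f i j)
      = (\<Prod>(j, k, i) \<in> ?B. ?f i j)"
    by (rule prod.reindex_bij_witness[of _ "\<lambda>(j, k, i). (i, j, k)" "\<lambda>(i, j, k). (j, k, i)"]) auto
  also have "\<dots> = (\<Prod>j = 1..n-1. \<Prod>(k, i) \<in> {j..n-1} \<times> {1..j}. ?f i j)"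
    by (rule prod.Sigma[symmetric]) auto
  also have "\<dots> = (\<Prod>j = 1..n-1. \<Prod>k = j..n-1. \<Prod>i = 1..j. ?f i j)"
    by (simp only: prod.cartesian_product)
  also have "\<dots> = (\<Prod>j = 1..n-1. to_fract (1 + monom 1 j) ^ (n - j))"
  proof (rule prod.cong[OF refl])
    fix j assume j: "j \<in> {1..n-1}"
    then have "1 \<le> j"
      by simp
    then show "(\<Prod>k = j..n-1. \<Prod>i = 1..j. ?f i j) = to_fract (1 + monom 1 j) ^ (n - j)"
      unfolding prod_q_int_telescope[OF \<open>1 \<le> j\<close>] using j assms by (simp add: Suc_diff_le)
  qed
  finally show ?thesis
    by (simp only: to_fract_prod to_fract_power)
qed

lemma card_eq_of_ideal_gf:
  assumes "1 \<le> n" and gf: "ideal_gf J = (\<Prod>j = 1..n-1. (1 + monom 1 j) ^ (n - j))"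
  shows "card J = 2 ^ (n choose 2)"
proof -
  have "int (card J) = poly (ideal_gf J) 1"
    by (simp add: ideal_gf_def poly_sum poly_monom)
  also have "\<dots> = (\<Prod>j = 1..n-1. 2 ^ (n - j))"
    by (simp add: gf poly_prod poly_monom)
  also have "\<dots> = 2 ^ (\<Sum>j = 1..n-1. n - j)"
    by (rule power_sum[symmetric])
  \<comment> \<open>The substitution of \<open>n - j\<close> for \<open>j\<close> misses only the
    index 0, whose term is zero.\<close>
  also have "(\<Sum>j = 1..n-1. n - j) = (\<Sum>j = 0..n-1. j)"
    by (rule sum.reindex_bij_witness_not_neutral[of "{}" "{0}" _ "\<lambda>j. n - j" "\<lambda>j. n - j"]) auto
  also have "\<dots> = n choose 2"
    using gauss_sum_nat[of "n - 1"] assms(1) by (simp add: choose_two mult.commute)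
  finally show ?thesis
    by (metis of_nat_eq_iff of_nat_numeral of_nat_power)
qed

section \<open>The two tetrahedral posets\<close>

text \<open>The integer bound \<open>int n - 2\<close> becomes a strict bound by the truncated
  \<open>n - 1\<close>, which is also right for \<open>n\<close> at most 1, where \<open>T n\<close>
  is empty.\<close>

lemma T_natE:
  assumes "u \<in> T n"
  obtains a b c where "u = (int a, int b, int c)" "a + b + c < n - 1"
proof -
  obtain a b c where u: "u = (a, b, c)"
    by (cases u)
  with assms show ?thesis
    by (intro that[of "nat a" "nat b" "nat c"]) (auto simp: T_def)
qed

lemma ideal_gf_T_red_green_blue:
  "ideal_gf (ideals (T n) (T_step n {Red, Green, Blue})) = ideal_gf (tower (n - 1))"
proof -
  let ?P = "{(a, b, c). a + b + c < n - 1}"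
  let ?E = "{(u, v). u \<in> ?P \<and> v \<in> ?P \<and> (case u of (a, b, c) \<Rightarrow> case v of (a', b', c') \<Rightarrow>
    (a' = Suc a \<and> b' = b \<or> a' = a \<and> b' = Suc b \<or> a = Suc a' \<and> b' = Suc b) \<and> c' = c)}"
  have "ideal_gf (ideals (T n) (T_step n {Red, Green, Blue})) = ideal_gf (ideals ?P ?E)"
  proof (rule ideal_gf_ideals_bij[where f = "\<lambda>(a, b, c). (nat a, nat b, nat c)"])
    show "bij_betw (\<lambda>(a, b, c). (nat a, nat b, nat c)) (T n) ?P"
      by (rule bij_betw_byWitness[of _ "\<lambda>(a, b, c). (int a, int b, int c)"]) (auto simp: T_def)
    fix u v assume uv: "u \<in> T n" "v \<in> T n"
    obtain a b c where u: "u = (int a, int b, int c)" "a + b + c < n - 1"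
      using uv(1) by (rule T_natE)
    obtain a' b' c' where v: "v = (int a', int b', int c')" "a' + b' + c' < n - 1"
      using uv(2) by (rule T_natE)
    have "(u, v) \<in> T_step n {Red, Green, Blue}
        \<longleftrightarrow> (a' = Suc a \<and> b' = b \<or> a' = a \<and> b' = Suc b \<or> a = Suc a' \<and> b' = Suc b) \<and> c' = c"
      using uv by (simp add: T_step_iff u(1) v(1)) linarith
    then show "((case u of (a, b, c) \<Rightarrow> (nat a, nat b, nat c)), (case v of (a, b, c) \<Rightarrow> (nat a, nat b, nat c))) \<in> ?E
        \<longleftrightarrow> (u, v) \<in> T_step n {Red, Green, Blue}"
      using u(2) v(2) by (simp add: u(1) v(1))
  qed (auto simp: T_step_iff)
  also have "ideals ?P ?E = tower (n - 1)"
  proof (intro Set.set_eqI iffI)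
    fix I assume I: "I \<in> ideals ?P ?E"
    then have sub: "I \<subseteq> ?P" and closed: "\<And>u v. (u, v) \<in> ?E \<Longrightarrow> v \<in> I \<Longrightarrow> u \<in> I"
      unfolding ideals_def by blast+
    show "I \<in> tower (n - 1)"
    proof (rule towerI)
      fix a b c
      show *: "a + b + c < n - 1" if "(a, b, c) \<in> I" for a b c
        using that sub by blast
      show "(a, b, c) \<in> I" if "(Suc a, b, c) \<in> I"
        by (rule closed[OF _ that]) (use *[OF that] in simp)
      show "(Suc a, b, c) \<in> I" if "(a, Suc b, c) \<in> I"
        by (rule closed[OF _ that]) (use *[OF that] in simp)
    qed
  next
    fix I assume I: "I \<in> tower (n - 1)"
    have closed: "u \<in> I" if uv: "(u, v) \<in> ?E" "v \<in> I" for u v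
    proof -
      obtain a b c where u: "u = (a, b, c)"
        by (cases u)
      \<comment> \<open>These are the Red, Green and Blue upper neighbours of \<open>u\<close>. The
        Green case reaches \<open>u\<close> through \<open>(Suc a, b, c)\<close>.\<close>
      with uv have "(Suc a, b, c) \<in> I \<or> (a, Suc b, c) \<in> I \<or> 0 < a \<and> (a - 1, Suc b, c) \<in> I"
        by auto
      then show ?thesis
        using tower_left[OF I, of a b c] tower_down[OF I, of a b c] tower_down[OF I, of "a - 1" b c]
        by (auto simp: u)
    qed
    show "I \<in> ideals ?P ?E"
      by (rule idealsI[OF tower_subset[OF I] closed])
  qed
  finally show ?thesis .
qed

text \<open>In the coordinates \<open>(k, j, x) = (a + c, c, b + 2 * c)\<close>, the pair
  \<open>(k, j)\<close> names a Green line and \<open>x\<close> is the position on it. Red raises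
  \<open>k\<close> alone, Green raises \<open>x\<close> alone, and Silver lowers all three by one:
  these are the closure conditions of \<open>gt_ideals\<close>.\<close>

lemma ideal_gf_T_red_green_silver:
  "ideal_gf (ideals (T n) (T_step n {Red, Green, Silver})) = ideal_gf (gt_ideals (n - 1) (\<lambda>j. 2 * j))"
proof -
  let ?P = "{(k, j, x). j \<le> k \<and> 2 * j \<le> x \<and> x + k < n - 1 + 2 * j}"
  let ?E = "{(u, v). u \<in> ?P \<and> v \<in> ?P \<and> (case u of (k, j, x) \<Rightarrow> case v of (k', j', x') \<Rightarrow>
    k' = k \<and> j' = j \<and> x' = Suc x \<or> k' = Suc k \<and> j' = j \<and> x' = x \<or> k = Suc k' \<and> j = Suc j' \<and> x = Suc x')}"
  let ?f = "\<lambda>(a, b, c). (nat (a + c), nat c, nat (b + 2 * c))"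
  have "ideal_gf (ideals (T n) (T_step n {Red, Green, Silver})) = ideal_gf (ideals ?P ?E)"
  proof (rule ideal_gf_ideals_bij[where f = ?f])
    show "bij_betw ?f (T n) ?P"
      by (rule bij_betw_byWitness[of _ "\<lambda>(k, j, x). (int k - int j, int x - 2 * int j, int j)"])
        (auto simp: T_def)
    fix u v assume uv: "u \<in> T n" "v \<in> T n"
    obtain a b c where u: "u = (int a, int b, int c)" "a + b + c < n - 1"
      using uv(1) by (rule T_natE)
    obtain a' b' c' where v: "v = (int a', int b', int c')" "a' + b' + c' < n - 1"
      using uv(2) by (rule T_natE)
    have f: "?f (int a, int b, int c) = (a + c, c, b + 2 * c)" for a b c
      by (simp add: nat_add_distrib nat_mult_distrib)
    have P: "(a + c, c, b + 2 * c) \<in> ?P" "(a' + c', c', b' + 2 * c') \<in> ?P"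
      using u(2) v(2) by simp_all
    have "(u, v) \<in> T_step n {Red, Green, Silver}
        \<longleftrightarrow> a' = Suc a \<and> b' = b \<and> c' = c \<or> a' = a \<and> b' = Suc b \<and> c' = c
          \<or> a' = a \<and> b' = Suc b \<and> c = Suc c'"
      using uv by (simp add: T_step_iff u(1) v(1)) linarith
    also have "\<dots> \<longleftrightarrow> (a' + c' = a + c \<and> c' = c \<and> b' + 2 * c' = Suc (b + 2 * c)
        \<or> a' + c' = Suc (a + c) \<and> c' = c \<and> b' + 2 * c' = b + 2 * c
        \<or> a + c = Suc (a' + c') \<and> c = Suc c' \<and> b + 2 * c = Suc (b' + 2 * c'))"
      by (rule iffI; elim disjE conjE; simp)
    also have "\<dots> \<longleftrightarrow> (?f u, ?f v) \<in> ?E"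
      unfolding u(1) v(1) f using P unfolding mem_Collect_eq prod.case by blast
    finally show "(?f u, ?f v) \<in> ?E \<longleftrightarrow> (u, v) \<in> T_step n {Red, Green, Silver}"
      by simp
  qed (auto simp: T_step_iff)
  also have "ideals ?P ?E = gt_ideals (n - 1) (\<lambda>j. 2 * j)"
  proof (intro Set.set_eqI iffI)
    fix I assume I: "I \<in> ideals ?P ?E"
    then have sub: "I \<subseteq> ?P" and closed: "\<And>u v. (u, v) \<in> ?E \<Longrightarrow> v \<in> I \<Longrightarrow> u \<in> I"
      unfolding ideals_def by blast+
    have *: "j \<le> k \<and> 2 * j \<le> x \<and> x + k < n - 1 + 2 * j" if "(k, j, x) \<in> I" for k j x
      using that sub by blast
    show "I \<in> gt_ideals (n - 1) (\<lambda>j. 2 * j)"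
    proof (rule gt_idealsI)
      have "I \<subseteq> {..<n} \<times> {..<n} \<times> {..<3 * n}"
        using * by force
      then show "finite I"
        by (rule finite_subset) simp
      fix k j x
      show "j \<le> k \<and> k < n - 1 \<and> 2 * j \<le> x" if "(k, j, x) \<in> I"
        using *[OF that] by simp
      show "(k, j, x) \<in> I" if "(k, j, Suc x) \<in> I" "2 * j \<le> x"
        by (rule closed[OF _ that(1)]) (use *[OF that(1)] that(2) in simp)
      show "(k, j, x) \<in> I" if "(Suc k, j, x) \<in> I" "j \<le> k"
        by (rule closed[OF _ that(1)]) (use *[OF that(1)] that(2) in simp)
      show "(Suc k, Suc j, Suc x) \<in> I" if "(k, j, x) \<in> I" "Suc k < n - 1" "Suc (2 * j) \<le> x"
        by (rule closed[OF _ that(1)]) (use *[OF that(1)] that(3) in simp)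
      show "Suc x < 2 * Suc j" if "Suc k = n - 1" "(k, j, x) \<in> I"
      proof -
        have "x + k < Suc k + 2 * j"
          using *[OF that(2)] unfolding that(1) by blast
        then show ?thesis
          by simp
      qed
    \<comment> \<open>What remains is the lower boundary condition, void because no \<open>x\<close>
      satisfies \<open>2 * j \<le> x\<close> and \<open>x < 2 * j\<close>.\<close>
    qed simp
  next
    fix I assume I: "I \<in> gt_ideals (n - 1) (\<lambda>j. 2 * j)"
    \<comment> \<open>The face of the tetrahedron opposite O is encoded only through the top row. A
      move by \<open>gt_ideals_right\<close> preserves \<open>x + k - 2 * j\<close>, so a point is
      pushed upwards until \<open>x = 2 * j\<close>, where the bound reads \<open>k < n - 1\<close>;
      in row \<open>n - 2\<close> the top row forces this.\<close>
    have bound: "x + k < n - 1 + 2 * j" if "(k, j, x) \<in> I" for k j x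
      using that
    proof (induction "n - k" arbitrary: k j x)
      case 0
      have "k < n - 1"
        using gt_ideals_bounds[OF I 0(2)] by blast
      with 0(1) show ?case
        by (simp add: less_diff_conv)
    next
      case (Suc m)
      have b: "k < n - 1" "2 * j \<le> x"
        using gt_ideals_bounds[OF I Suc.prems] by simp_all
      show ?case
      proof (cases "x = 2 * j")
        case False
        have "Suc k \<noteq> n - 1"
          using gt_ideals_upper[OF I _ Suc.prems] False b(2) by auto
        then have "(Suc k, Suc j, Suc x) \<in> I"
          using gt_ideals_right[OF I Suc.prems] False b by simp
        then have "Suc x + Suc k < n - 1 + 2 * Suc j"
          using Suc.hyps(1)[of "Suc k" "Suc j" "Suc x"] Suc.hyps(2) by simp
        then show ?thesis by simp
      qed (use b in simp)
    qed
    have closed: "u \<in> I" if uv: "(u, v) \<in> ?E" "v \<in> I" for u v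
    proof -
      obtain k j x where u: "u = (k, j, x)"
        by (cases u)
      obtain k' j' x' where v: "v = (k', j', x')"
        by (cases v)
      have u': "j \<le> k" "2 * j \<le> x" "x + k < n - 1 + 2 * j"
        and "k' = k \<and> j' = j \<and> x' = Suc x \<or> k' = Suc k \<and> j' = j \<and> x' = x
          \<or> k = Suc k' \<and> j = Suc j' \<and> x = Suc x'"
        using uv(1) by (simp_all add: u v)
      from this(4) show ?thesis
      proof (elim disjE conjE)
        assume "k' = k" "j' = j" "x' = Suc x"
        then show ?thesis
          using uv(2) gt_ideals_chain[OF I, of k j x] u' by (simp add: u v)
      next
        assume "k' = Suc k" "j' = j" "x' = x"
        then show ?thesis
          using uv(2) gt_ideals_left[OF I, of k j x] u' by (simp add: u v)
      next
        assume "k = Suc k'" "j = Suc j'" "x = Suc x'"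
        then show ?thesis
          using uv(2) gt_ideals_right[OF I, of k' j' x'] u' by (simp add: u v)
      qed
    qed
    have sub: "I \<subseteq> ?P"
    proof
      fix p assume p: "p \<in> I"
      obtain k j x where kjx: "p = (k, j, x)"
        by (cases p)
      show "p \<in> ?P"
        using bound[of k j x] gt_ideals_bounds[OF I, of k j x] p by (simp add: kjx)
    qed
    show "I \<in> ideals ?P ?E"
      by (rule idealsI[OF sub closed])
  qed
  finally show ?thesis .
qed

theorem theorem2p8:
  fixes n :: nat and S :: "color set"
  assumes "n \<ge> 1"
    and "admissible S"
    and "card S = 3"
    and "S \<notin> {{Red, Green, Yellow}, {Silver, Blue, Green}}"
  shows "ideal_gf (order_ideals (T n) (T_order n S))
           = (\<Prod>j = 1..n-1. (1 + monom 1 j) ^ (n - j))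
         \<and> to_fract (ideal_gf (order_ideals (T n) (T_order n S)))
           = (\<Prod>(i, j, k) \<in> {(i, j, k). 1 \<le> i \<and> i \<le> j \<and> j \<le> k \<and> k \<le> n - 1}.
                to_fract (q_int (i + j)) / to_fract (q_int (i + j - 1)))
         \<and> card (order_ideals (T n) (T_order n S)) = 2 ^ (n choose 2)"
proof -
  from admissible_card_3_cases[OF assms(2-4)]
  have "ideal_gf (order_ideals (T n) (T_order n S)) = (\<Prod>j\<le>n-1. \<Prod>d = 1..j. 1 + monom 1 d)"
    unfolding order_ideals_T_order
    by (elim disjE)
      (simp_all only: ideal_gf_T_chain ideal_gf_T_red_green_blue ideal_gf_tower
        ideal_gf_T_zigzag ideal_gf_T_red_green_silver ideal_gf_gt_ideals_even)
  \<comment> \<open>The exponent \<open>Suc (n - 1) - d\<close> equals \<open>n - d\<close> because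
    \<open>n\<close> is positive.\<close>
  also have "\<dots> = (\<Prod>j = 1..n-1. (1 + monom 1 j) ^ (n - j))"
    unfolding prod_triangle_power using assms(1) by simp
  finally have gf: "ideal_gf (order_ideals (T n) (T_order n S)) = (\<Prod>j = 1..n-1. (1 + monom 1 j) ^ (n - j))" .
  then show ?thesis
    using prod_q_int_quotients[OF assms(1)] card_eq_of_ideal_gf[OF assms(1) gf] by simp
qed

end
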